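(* Consider a symmetric deterministic 2-receiver discrete memoryless broadcast channel with random state, and let $R_{\mathrm{sym-sp}}$ be the maximum symmetric rate achievable with the superposition-coding choice of auxiliary random variables (as defined in the context). Then $$R_{\mathrm{sym-sp}}=\max_{p(u_0,x)}\min\left\{\tfrac12 I(X;Y_1|S)+\tfrac14 I(X;Y_2|Y_1,U_0,S),\ \tfrac12 I(X;Y_1|S)+\tfrac12 I(U_0;Y_1|S)\right\},$$ where the maximum is over joint pmfs $p(u_0,x)$ with $U_0$ taking values in an arbitrary finite alphabet and $X\in\mathcal X$, with $(U_0,X)$ independent of $S\sim p(s)$ and $Y_i=y_i(X,S)$.
   Context: All alphabets are finite. A 2-receiver discrete memoryless broadcast channel (DM-BC) with random state consists of an input alphabet $\mathcal X$, output alphabets $\mathcal Y_1,\mathcal Y_2$, a state $S\sim p(s)$ on $\mathcal S$, and a conditional pmf $p(y_1,y_2|x,s)$. It is symmetric if $\mathcal Y_1=\mathcal Y_2=\mathcal Y$, $\mathcal S=\{1,\dots,|\mathcal S|\}$, and there is a bijection $\pi:\mathcal S\to\mathcal S$ with $p_S(s)=p_S(\pi(s))$ and $p_{Y_1|X,S}(y|x,s)=p_{Y_2|X,S}(y|x,\pi(s))$ for all $x,y,s$. It is symmetric deterministic if in addition $Y_1=y_1(X,S)$ and $Y_2=y_2(X,S)$ for deterministic functions $y_1,y_2$. Auxiliary random variables: a choice of auxiliaries is a tuple of finite-alphabet random variables $(U_0,U_1,U_2,V_0,V_1,V_2,Q)$ and a function $x(u_0,u_1,u_2,q)$ such that the joint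 pmf of all variables is $$p(q)\,p(u_0,u_1,u_2|q)\,\mathbf 1_{x=x(u_0,u_1,u_2,q)}\,p(s)\,p(y_1,y_2|x,s)\,p(v_0,v_1,v_2|u_0,u_1,u_2,s,q).$$ For a choice of auxiliaries, the Shayevitz--Wigger inequalities (for state known at both decoders and strictly causally at the encoder) on nonnegative $(R_1,R_2)$ are $$ \begin{aligned} R_1 \le{}& I(U_0,U_1;Y_1,V_1|Q,S)-I(U_0,U_1,U_2;V_0,V_1|Q,Y_1,S),\\ R_2 \le{}& I(U_0,U_2;Y_2,V_2|Q,S)-I(U_0,U_1,U_2;V_0,V_2|Q,Y_2,S),\\ R_1+R_2 \le{}& I(U_1;Y_1,V_1|Q,U_0,S)+I(U_2;Y_2,V_2|Q,U_0,S)+\min_{i\in\{1,2\}}I(U_0;Y_i,V_i|Q,S)\\ &-I(U_1;U_2|Q,U_0)-I(U_0,U_1,U_2;V_1|Q,V_0,Y_1,S)-I(U_0,U_1,U_2;V_2|Q,V_0,Y_2,S)\\ &-\max_{i\in\{1,2\}}I(U_0,U_1,U_2;V_0|Q,Y_i,S),\\ R_1+R_2 \le{}& I(U_0,U_1;Y_1,V_1|Q,S)+I(U_0,U_2;Y_2,V_2|Q,S)-I(U_1;U_2|Q,U_0)\\ &-I(U_0,U_1,U_2;V_0,V_1|Q,Y_1,S)-I(U_0,U_1,U_2;V_0,V_2|Q,Y_2,S). \end{aligned} $$ Superposition-coding choice: $Q\in\{1,2\}$ with $p_Q(1)=p_Q(2)=1/2$; $U_0$ has an arbitrary finite alphabet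 and $U_1,U_2$ take values in $\mathcal X$, with $p(q,u_0,u_1,u_2)=p(q)p(u_0)p(u_1|u_0)p(u_2|u_0)$ and $p_{U_1|U_0}(u|u_0)=p_{U_2|U_0}(u|u_0)$ for all $u,u_0$; $V_0=V_1=V_2$ equals $Y_2$ if $Q=1$ and $Y_1$ if $Q=2$; and $X=U_1$ if $Q=1$, $X=U_2$ if $Q=2$. (Since the channel is deterministic, the $V$'s are functions of $(U_0,U_1,U_2,S,Q)$.) $R_{\mathrm{sym-sp}}$ is the supremum of $R$ such that $(R,R)$ satisfies the four Shayevitz--Wigger inequalities for some superposition-coding choice, i.e. some $p(u_0)$ and common conditional pmf $p_{U_1|U_0}=p_{U_2|U_0}$. *)

theory Defs
  imports "HOL-Probability.Probability"
begin

text \<open>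
  A two-receiver DM-BC with random state is given by the state pmf \<open>pS\<close> and the kernel
  \<open>W x s\<close>, the conditional pmf \<open>p(y1, y2 | x, s)\<close>. The channel alphabets are types of class
  \<open>finite\<close>; the labelling \<open>{1, \<dots>, |S|}\<close> of the states plays no role and is dropped.
\<close>

definition symmetric_bc :: "'s::finite pmf \<Rightarrow> ('x::finite \<Rightarrow> 's \<Rightarrow> ('y::finite \<times> 'y) pmf) \<Rightarrow> bool" where
  "symmetric_bc pS W \<longleftrightarrow>
     (\<exists>\<pi>. bij \<pi> \<and> (\<forall>s. pmf pS s = pmf pS (\<pi> s)) \<and>
        (\<forall>x y s. pmf (map_pmf fst (W x s)) y = pmf (map_pmf snd (W x (\<pi> s))) y))"

definition symmetric_deterministic_bc ::
  "'s::finite pmf \<Rightarrow> ('x::finite \<Rightarrow> 's \<Rightarrow> ('y::finite \<times> 'y) pmf) \<Rightarrow>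
   ('x \<Rightarrow> 's \<Rightarrow> 'y) \<Rightarrow> ('x \<Rightarrow> 's \<Rightarrow> 'y) \<Rightarrow> bool" where
  "symmetric_deterministic_bc pS W y1 y2 \<longleftrightarrow>
     symmetric_bc pS W \<and> (\<forall>x s. W x s = return_pmf (y1 x s, y2 x s))"

text \<open>
  Logarithms are to base 2. The class \<open>countable\<close> guarantees that products of the counting
  spaces again have all subsets as measurable sets.
\<close>

definition cmi ::
  "'a pmf \<Rightarrow> ('a \<Rightarrow> 'b::countable) \<Rightarrow> ('a \<Rightarrow> 'c::countable) \<Rightarrow> ('a \<Rightarrow> 'd::countable) \<Rightarrow> real" where
  "cmi p X Y Z =
     prob_space.conditional_mutual_information (measure_pmf p) 2
       (count_space UNIV) (count_space UNIV) (count_space UNIV) X Y Z"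

text \<open>
  The alphabets of the auxiliaries are arbitrary countable types here, so that an alphabet of
  arbitrary finite size can be taken to be a finite subset of a fixed type;
  \<open>finite_alphabets\<close> imposes finiteness.
\<close>

record ('q, 'u0, 'u1, 'u2, 'v0, 'v1, 'v2, 'x, 's) auxiliaries =
  aux_pQ :: "'q pmf"
  aux_pU :: "'q \<Rightarrow> ('u0 \<times> 'u1 \<times> 'u2) pmf"
  aux_x :: "'u0 \<Rightarrow> 'u1 \<Rightarrow> 'u2 \<Rightarrow> 'q \<Rightarrow> 'x"
  aux_pV :: "'u0 \<Rightarrow> 'u1 \<Rightarrow> 'u2 \<Rightarrow> 's \<Rightarrow> 'q \<Rightarrow> ('v0 \<times> 'v1 \<times> 'v2) pmf"

record ('q, 'u0, 'u1, 'u2, 'v0, 'v1, 'v2, 'x, 's, 'y1, 'y2) outcome =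
  rvQ :: 'q
  rvU0 :: 'u0
  rvU1 :: 'u1
  rvU2 :: 'u2
  rvX :: 'x
  rvS :: 's
  rvY1 :: 'y1
  rvY2 :: 'y2
  rvV0 :: 'v0
  rvV1 :: 'v1
  rvV2 :: 'v2

definition joint_pmf ::
  "'s pmf \<Rightarrow> ('x \<Rightarrow> 's \<Rightarrow> ('y1 \<times> 'y2) pmf) \<Rightarrow>
   ('q, 'u0, 'u1, 'u2, 'v0, 'v1, 'v2, 'x, 's) auxiliaries \<Rightarrow>
   ('q, 'u0, 'u1, 'u2, 'v0, 'v1, 'v2, 'x, 's, 'y1, 'y2) outcome pmf" where
  "joint_pmf pS W A =
     bind_pmf (aux_pQ A) (\<lambda>q.
     bind_pmf (aux_pU A q) (\<lambda>(u0, u1, u2).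
     bind_pmf pS (\<lambda>s.
     bind_pmf (W (aux_x A u0 u1 u2 q) s) (\<lambda>(y1, y2).
     bind_pmf (aux_pV A u0 u1 u2 s q) (\<lambda>(v0, v1, v2).
     return_pmf \<lparr>rvQ = q, rvU0 = u0, rvU1 = u1, rvU2 = u2, rvX = aux_x A u0 u1 u2 q,
       rvS = s, rvY1 = y1, rvY2 = y2, rvV0 = v0, rvV1 = v1, rvV2 = v2\<rparr>)))))"

definition finite_alphabets ::
  "('q, 'u0, 'u1, 'u2, 'v0, 'v1, 'v2, 'x, 's) auxiliaries \<Rightarrow> bool" where
  "finite_alphabets A \<longleftrightarrow>
     finite (set_pmf (aux_pQ A)) \<and> (\<forall>q. finite (set_pmf (aux_pU A q))) \<and>
     (\<forall>u0 u1 u2 s q. finite (set_pmf (aux_pV A u0 u1 u2 s q)))"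

definition shayevitz_wigger ::
  "('q::countable, 'u0::countable, 'u1::countable, 'u2::countable,
    'v0::countable, 'v1::countable, 'v2::countable,
    'x, 's::countable, 'y1::countable, 'y2::countable) outcome pmf \<Rightarrow> real \<Rightarrow> real \<Rightarrow> bool" where
  "shayevitz_wigger p R1 R2 \<longleftrightarrow>
    (let Q = rvQ; U0 = rvU0; U1 = rvU1; U2 = rvU2; S = rvS; Y1 = rvY1; Y2 = rvY2;
         V0 = rvV0; V1 = rvV1; V2 = rvV2; U = (\<lambda>\<omega>. (U0 \<omega>, U1 \<omega>, U2 \<omega>)) in
     0 \<le> R1 \<and> 0 \<le> R2 \<and>
     R1 \<le> cmi p (\<lambda>\<omega>. (U0 \<omega>, U1 \<omega>)) (\<lambda>\<omega>. (Y1 \<omega>, V1 \<omega>)) (\<lambda>\<omega>. (Q \<omega>, S \<omega>))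
          - cmi p U (\<lambda>\<omega>. (V0 \<omega>, V1 \<omega>)) (\<lambda>\<omega>. (Q \<omega>, Y1 \<omega>, S \<omega>)) \<and>
     R2 \<le> cmi p (\<lambda>\<omega>. (U0 \<omega>, U2 \<omega>)) (\<lambda>\<omega>. (Y2 \<omega>, V2 \<omega>)) (\<lambda>\<omega>. (Q \<omega>, S \<omega>))
          - cmi p U (\<lambda>\<omega>. (V0 \<omega>, V2 \<omega>)) (\<lambda>\<omega>. (Q \<omega>, Y2 \<omega>, S \<omega>)) \<and>
     R1 + R2 \<le>
          cmi p U1 (\<lambda>\<omega>. (Y1 \<omega>, V1 \<omega>)) (\<lambda>\<omega>. (Q \<omega>, U0 \<omega>, S \<omega>))
          + cmi p U2 (\<lambda>\<omega>. (Y2 \<omega>, V2 \<omega>)) (\<lambda>\<omega>. (Q \<omega>, U0 \<omega>, S \<omega>))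
          + min (cmi p U0 (\<lambda>\<omega>. (Y1 \<omega>, V1 \<omega>)) (\<lambda>\<omega>. (Q \<omega>, S \<omega>)))
                (cmi p U0 (\<lambda>\<omega>. (Y2 \<omega>, V2 \<omega>)) (\<lambda>\<omega>. (Q \<omega>, S \<omega>)))
          - cmi p U1 U2 (\<lambda>\<omega>. (Q \<omega>, U0 \<omega>))
          - cmi p U V1 (\<lambda>\<omega>. (Q \<omega>, V0 \<omega>, Y1 \<omega>, S \<omega>))
          - cmi p U V2 (\<lambda>\<omega>. (Q \<omega>, V0 \<omega>, Y2 \<omega>, S \<omega>))
          - max (cmi p U V0 (\<lambda>\<omega>. (Q \<omega>, Y1 \<omega>, S \<omega>)))
                (cmi p U V0 (\<lambda>\<omega>. (Q \<omega>, Y2 \<omega>, S \<omega>))) \<and>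
     R1 + R2 \<le>
          cmi p (\<lambda>\<omega>. (U0 \<omega>, U1 \<omega>)) (\<lambda>\<omega>. (Y1 \<omega>, V1 \<omega>)) (\<lambda>\<omega>. (Q \<omega>, S \<omega>))
          + cmi p (\<lambda>\<omega>. (U0 \<omega>, U2 \<omega>)) (\<lambda>\<omega>. (Y2 \<omega>, V2 \<omega>)) (\<lambda>\<omega>. (Q \<omega>, S \<omega>))
          - cmi p U1 U2 (\<lambda>\<omega>. (Q \<omega>, U0 \<omega>))
          - cmi p U (\<lambda>\<omega>. (V0 \<omega>, V1 \<omega>)) (\<lambda>\<omega>. (Q \<omega>, Y1 \<omega>, S \<omega>))
          - cmi p U (\<lambda>\<omega>. (V0 \<omega>, V2 \<omega>)) (\<lambda>\<omega>. (Q \<omega>, Y2 \<omega>, S \<omega>)))"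

text \<open>
  \<open>K u0\<close> is the common conditional pmf of \<open>U1\<close> and of \<open>U2\<close> given \<open>U0 = u0\<close>. The \<open>V\<close>'s equal
  \<open>Y2\<close> or \<open>Y1\<close>, which under a deterministic channel are the values of \<open>y2\<close> and \<open>y1\<close> at \<open>(X, S)\<close>.
  Since \<open>Q\<close> is almost surely 1 or 2, the \<open>else\<close> branches are the case \<open>Q = 2\<close>.
\<close>

definition superposition_x :: "'u0 \<Rightarrow> 'x \<Rightarrow> 'x \<Rightarrow> nat \<Rightarrow> 'x" where
  "superposition_x u0 u1 u2 q = (if q = 1 then u1 else u2)"

definition superposition_choice ::
  "('x \<Rightarrow> 's \<Rightarrow> 'y) \<Rightarrow> ('x \<Rightarrow> 's \<Rightarrow> 'y) \<Rightarrow> 'u0 pmf \<Rightarrow> ('u0 \<Rightarrow> 'x pmf) \<Rightarrow>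
   (nat, 'u0, 'x, 'x, 'y, 'y, 'y, 'x, 's) auxiliaries" where
  "superposition_choice y1 y2 pU0 K =
     \<lparr>aux_pQ = pmf_of_set {1, 2},
      aux_pU = (\<lambda>q. bind_pmf pU0 (\<lambda>u0. bind_pmf (K u0) (\<lambda>u1. bind_pmf (K u0) (\<lambda>u2.
                  return_pmf (u0, u1, u2))))),
      aux_x = superposition_x,
      aux_pV = (\<lambda>u0 u1 u2 s q.
        let x = superposition_x u0 u1 u2 q; v = (if q = 1 then y2 x s else y1 x s)
        in return_pmf (v, v, v))\<rparr>"

definition R_sym_sp ::
  "'s::finite pmf \<Rightarrow> ('x::finite \<Rightarrow> 's \<Rightarrow> ('y::finite \<times> 'y) pmf) \<Rightarrow>
   ('x \<Rightarrow> 's \<Rightarrow> 'y) \<Rightarrow> ('x \<Rightarrow> 's \<Rightarrow> 'y) \<Rightarrow> real" where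
  "R_sym_sp pS W y1 y2 =
     Sup {R. \<exists>(pU0 :: nat pmf) K.
            finite_alphabets (superposition_choice y1 y2 pU0 K) \<and>
            shayevitz_wigger (joint_pmf pS W (superposition_choice y1 y2 pU0 K)) R R}"

definition symmetric_rate_bound ::
  "'s::finite pmf \<Rightarrow> ('x::finite \<Rightarrow> 's \<Rightarrow> 'y::finite) \<Rightarrow> ('x \<Rightarrow> 's \<Rightarrow> 'y) \<Rightarrow>
   ('u0::countable \<times> 'x) pmf \<Rightarrow> real" where
  "symmetric_rate_bound pS y1 y2 pUX =
     (let p = pair_pmf pUX pS;
          U0 = (\<lambda>((u0, x), s). u0); X = (\<lambda>((u0, x), s). x); S = (\<lambda>((u0, x), s). s);
          Y1 = (\<lambda>((u0, x), s). y1 x s); Y2 = (\<lambda>((u0, x), s). y2 x s)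
      in min (1/2 * cmi p X Y1 S + 1/4 * cmi p X Y2 (\<lambda>\<omega>. (Y1 \<omega>, U0 \<omega>, S \<omega>)))
             (1/2 * cmi p X Y1 S + 1/2 * cmi p U0 Y1 S))"

end

theory Submission
  imports Defs "HOL-Real_Asymp.Real_Asymp"
begin

text \<open>
  With all mutual informations written in terms of entropies, averaging over \<open>Q\<close> and using that the
  channel is deterministic and that the idle auxiliary is independent of the transmission given \<open>U0\<close>,
  the right-hand side of each individual inequality becomes
  \<open>(H(Y1|S) + I(U0;Y1|S)) / 2\<close>, half of that of the fourth. The third right-hand side becomes
  \<open>H(Y1|S) + H(Y2|Y1,U0,S) / 2\<close>. The symmetry of the channel enters through
  \<open>H(Y1|S) = H(Y2|S)\<close> and \<open>H(Y1|U0,S) = H(Y2|U0,S)\<close>. So the achievable \<open>R\<close> for a given \<open>p(u0, x)\<close> are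
  exactly those between 0 and the claimed minimum, and it remains to see that the supremum over
  \<open>p(u0, x)\<close> is attained. The minimum is a continuous function of
  \<open>(p(x), H(Y1,S|U0), H(Y1,Y2,S|U0))\<close>, and these triples form the convex hull of a compact set.
\<close>

section \<open>Conditional mutual information of finitely supported distributions\<close>

text \<open>Shannon entropy in bits. For an infinite support the sum takes the default value 0, so
  statements beyond relabelling assume a finite support.\<close>

definition pmf_entropy :: "'a pmf \<Rightarrow> real" where
  "pmf_entropy p = (\<Sum>x\<in>set_pmf p. - (pmf p x * log 2 (pmf p x)))"

abbreviation entropy_of :: "'a pmf \<Rightarrow> ('a \<Rightarrow> 'b) \<Rightarrow> real" where
  "entropy_of p X \<equiv> pmf_entropy (map_pmf X p)"

lemma pmf_entropy_map_inj:
  assumes "inj_on f (set_pmf p)"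
  shows "pmf_entropy (map_pmf f p) = pmf_entropy p"
  unfolding pmf_entropy_def set_map_pmf using assms
  by (simp add: sum.reindex pmf_map_inj)

text \<open>Entropy depends only on the partition of the support that a variable induces: a map that
  is injective on the values of \<open>A\<close> carries them to those of \<open>B\<close>. This
  serves to permute, duplicate or drop determined components.\<close>

lemma entropy_of_cong:
  assumes "\<And>\<omega> \<omega>'. \<omega> \<in> set_pmf p \<Longrightarrow> \<omega>' \<in> set_pmf p \<Longrightarrow> A \<omega> = A \<omega>' \<longleftrightarrow> B \<omega> = B \<omega>'"
  shows "entropy_of p A = entropy_of p B"
proof -
  let ?inv = "inv_into (set_pmf p) A"
  define f where "f = B \<circ> ?inv"
  have f: "f (A \<omega>) = B \<omega>" if "\<omega> \<in> set_pmf p" for \<omega>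
  proof -
    have "?inv (A \<omega>) \<in> set_pmf p" "A (?inv (A \<omega>)) = A \<omega>"
      using that by (auto intro: inv_into_into f_inv_into_f)
    then have "B (?inv (A \<omega>)) = B \<omega>"
      using that assms by blast
    then show ?thesis unfolding f_def comp_apply .
  qed
  have "map_pmf f (map_pmf A p) = map_pmf B p"
    unfolding map_pmf_comp using f by (intro map_pmf_cong refl)
  moreover have "pmf_entropy (map_pmf f (map_pmf A p)) = entropy_of p A"
    by (rule pmf_entropy_map_inj) (auto simp: inj_on_def f assms)
  ultimately show ?thesis by simp
qed

text \<open>Chain rule H(U,X) = H(U) + H(X|U): the joint masses are products, so the logarithm
  splits, and the masses of \<open>K u\<close> sum to 1.\<close>

lemma pmf_entropy_bind:
  assumes "finite (set_pmf q)" "\<And>u. u \<in> set_pmf q \<Longrightarrow> finite (set_pmf (K u))"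
  shows "pmf_entropy (bind_pmf q (\<lambda>u. map_pmf (Pair u) (K u))) =
    pmf_entropy q + (\<Sum>u\<in>set_pmf q. pmf q u * pmf_entropy (K u))"
proof -
  let ?p = "bind_pmf q (\<lambda>u. map_pmf (Pair u) (K u))"
  have pmf: "pmf ?p (u, x) = pmf q u * pmf (K u) x" for u x
  proof -
    have "pmf ?p (u, x) = (\<Sum>a\<in>{u}. pmf (map_pmf (Pair a) (K a)) (u, x) * pmf q a)"
      unfolding pmf_bind
      by (rule integral_measure_pmf_real) (auto simp: pmf_eq_0_set_pmf)
    also have "\<dots> = pmf q u * pmf (K u) x"
      using pmf_map_inj'[of "Pair u" "K u" x] by (simp add: inj_on_def)
    finally show ?thesis .
  qed
  have S: "set_pmf ?p = Sigma (set_pmf q) (\<lambda>u. set_pmf (K u))"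
    by auto
  have "pmf_entropy ?p =
      (\<Sum>u\<in>set_pmf q. \<Sum>x\<in>set_pmf (K u). - (pmf ?p (u, x) * log 2 (pmf ?p (u, x))))"
    unfolding pmf_entropy_def S by (subst sum.Sigma) (use assms in auto)
  also have "\<dots> = (\<Sum>u\<in>set_pmf q. \<Sum>x\<in>set_pmf (K u).
      - (pmf q u * log 2 (pmf q u)) * pmf (K u) x
      + pmf q u * (- (pmf (K u) x * log 2 (pmf (K u) x))))"
    unfolding pmf
  proof (intro sum.cong refl)
    fix u x assume "u \<in> set_pmf q" "x \<in> set_pmf (K u)"
    then have "pmf q u > 0" "pmf (K u) x > 0" by (simp_all add: pmf_positive)
    then show "- (pmf q u * pmf (K u) x * log 2 (pmf q u * pmf (K u) x)) =
      - (pmf q u * log 2 (pmf q u)) * pmf (K u) x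
      + pmf q u * (- (pmf (K u) x * log 2 (pmf (K u) x)))"
      by (simp add: log_mult algebra_simps)
  qed
  also have "\<dots> = (\<Sum>u\<in>set_pmf q. - (pmf q u * log 2 (pmf q u)) + pmf q u * pmf_entropy (K u))"
  proof (intro sum.cong refl)
    fix u assume "u \<in> set_pmf q"
    then have "(\<Sum>x\<in>set_pmf (K u). pmf (K u) x) = 1"
      using assms by (intro sum_pmf_eq_1) auto
    then show "(\<Sum>x\<in>set_pmf (K u). - (pmf q u * log 2 (pmf q u)) * pmf (K u) x
        + pmf q u * (- (pmf (K u) x * log 2 (pmf (K u) x))))
      = - (pmf q u * log 2 (pmf q u)) + pmf q u * pmf_entropy (K u)"
      by (simp only: sum.distrib sum_distrib_left[symmetric] pmf_entropy_def mult_1_right)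
  qed
  finally show ?thesis
    by (simp only: sum.distrib pmf_entropy_def[of q])
qed

lemma pmf_entropy_pair:
  assumes "finite (set_pmf a)" "finite (set_pmf c)"
  shows "pmf_entropy (pair_pmf a c) = pmf_entropy a + pmf_entropy c"
proof -
  have "pair_pmf a c = bind_pmf a (\<lambda>u. map_pmf (Pair u) c)"
    by (simp add: pair_pmf_def map_pmf_def)
  then show ?thesis
    using assms
    by (simp add: pmf_entropy_bind sum_distrib_right[symmetric] sum_pmf_eq_1)
qed

section \<open>Mutual information in terms of entropies\<close>

lemma sum_map_pmf:
  fixes f :: "'b \<Rightarrow> real"
  assumes "finite (set_pmf p)"
  shows "(\<Sum>x\<in>set_pmf (map_pmf X p). pmf (map_pmf X p) x * f x)
    = (\<Sum>\<omega>\<in>set_pmf p. pmf p \<omega> * f (X \<omega>))"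
proof -
  have "(\<Sum>x\<in>set_pmf (map_pmf X p). f x * pmf (map_pmf X p) x) = measure_pmf.expectation (map_pmf X p) f"
    by (rule integral_measure_pmf_real[symmetric]) (use assms in auto)
  also have "\<dots> = measure_pmf.expectation p (\<lambda>\<omega>. f (X \<omega>))"
    by simp
  also have "\<dots> = (\<Sum>\<omega>\<in>set_pmf p. f (X \<omega>) * pmf p \<omega>)"
    by (rule integral_measure_pmf_real) (use assms in auto)
  finally show ?thesis by (simp add: mult.commute)
qed

lemma distributed_map_pmf:
  "distributed (measure_pmf p) (count_space UNIV) X (\<lambda>x. ennreal (pmf (map_pmf X p) x))"
  unfolding distributed_def measure_pmf_eq_density[symmetric] map_pmf_rep_eq by simp

text \<open>The densities are the mass functions, and the product of counting spaces on countable
  types is again a counting space, so the integral becomes a finite sum over the support of the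
  joint law.\<close>

lemma mutual_information_pmf:
  fixes X :: "'a \<Rightarrow> 'b::countable" and Y :: "'a \<Rightarrow> 'c::countable"
  assumes "finite (set_pmf p)"
  shows "prob_space.mutual_information (measure_pmf p) 2 (count_space UNIV) (count_space UNIV) X Y
    = entropy_of p X + entropy_of p Y - entropy_of p (\<lambda>\<omega>. (X \<omega>, Y \<omega>))"
proof -
  interpret information_space "measure_pmf p" 2
    by unfold_locales simp
  let ?X = "map_pmf X p" and ?Y = "map_pmf Y p" and ?XY = "map_pmf (\<lambda>\<omega>. (X \<omega>, Y \<omega>)) p"
  have C: "sigma_finite_measure (count_space (UNIV :: 'b set))"
    "sigma_finite_measure (count_space (UNIV :: 'c set))"
    by (auto intro!: sigma_finite_measure_count_space_countable)
  have P: "count_space UNIV \<Otimes>\<^sub>M count_space UNIV = count_space (UNIV :: ('b \<times> 'c) set)"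
    by (simp add: pair_measure_countable)
  note D = distributed_map_pmf
  have fin: "finite (set_pmf ?XY)" using assms by simp
  let ?f = "\<lambda>z. pmf ?XY z * log 2 (pmf ?XY z / (pmf ?X (fst z) * pmf ?Y (snd z)))"
  have "prob_space.mutual_information (measure_pmf p) 2 (count_space UNIV) (count_space UNIV) X Y =
      integral\<^sup>L (count_space UNIV \<Otimes>\<^sub>M count_space UNIV) ?f"
    by (rule mutual_information_distr[OF C D[of p X] _ D[of p Y] _
        D[of p "\<lambda>\<omega>. (X \<omega>, Y \<omega>)", folded P]]) auto
  also have "\<dots> = (\<Sum>z | z \<in> UNIV \<and> ?f z \<noteq> 0. ?f z)"
    unfolding P
    by (rule lebesgue_integral_count_space_finite_support, rule finite_subset[of _ "set_pmf ?XY"])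
      (use fin in \<open>auto simp: pmf_eq_0_set_pmf simp del: set_map_pmf\<close>)
  also have "\<dots> = (\<Sum>z\<in>set_pmf ?XY. ?f z)"
    by (rule sum.mono_neutral_left) (use fin in \<open>auto simp: pmf_eq_0_set_pmf simp del: set_map_pmf\<close>)
  also have "\<dots> = (\<Sum>z\<in>set_pmf ?XY. - (pmf ?XY z * log 2 (pmf ?X (fst z)))
      - pmf ?XY z * log 2 (pmf ?Y (snd z)) - - (pmf ?XY z * log 2 (pmf ?XY z)))"
  proof (rule sum.cong[OF refl])
    fix z assume "z \<in> set_pmf ?XY"
    then have "pmf ?XY z > 0" "pmf ?X (fst z) > 0" "pmf ?Y (snd z) > 0"
      by (auto intro!: pmf_positive)
    then show "?f z = - (pmf ?XY z * log 2 (pmf ?X (fst z)))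
      - pmf ?XY z * log 2 (pmf ?Y (snd z)) - - (pmf ?XY z * log 2 (pmf ?XY z))"
      by (simp add: log_divide log_mult algebra_simps)
  qed
  also have "\<dots> = (\<Sum>z\<in>set_pmf ?XY. - (pmf ?XY z * log 2 (pmf ?X (fst z))))
      + (\<Sum>z\<in>set_pmf ?XY. - (pmf ?XY z * log 2 (pmf ?Y (snd z)))) - pmf_entropy ?XY"
    unfolding pmf_entropy_def sum_subtractf sum_negf by simp
  \<comment> \<open>The logarithm next to the joint mass depends on one coordinate only, so the sum
    passes to the marginal.\<close>
  also have "(\<Sum>z\<in>set_pmf ?XY. - (pmf ?XY z * log 2 (pmf ?X (fst z)))) = pmf_entropy ?X"
    using sum_map_pmf[of ?XY fst "\<lambda>x. - log 2 (pmf ?X x)"] assms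
    by (simp add: pmf_entropy_def map_pmf_comp)
  also have "(\<Sum>z\<in>set_pmf ?XY. - (pmf ?XY z * log 2 (pmf ?Y (snd z)))) = pmf_entropy ?Y"
    using sum_map_pmf[of ?XY snd "\<lambda>x. - log 2 (pmf ?Y x)"] assms
    by (simp add: pmf_entropy_def map_pmf_comp)
  finally show ?thesis .
qed

text \<open>I(X;Y|Z) is defined as I(X;(Y,Z)) - I(X;Z); the two copies of H(X) cancel.\<close>

lemma cmi_eq_entropy:
  assumes "finite (set_pmf p)"
  shows "cmi p X Y Z = entropy_of p (\<lambda>\<omega>. (X \<omega>, Z \<omega>)) + entropy_of p (\<lambda>\<omega>. (Y \<omega>, Z \<omega>))
    - entropy_of p (\<lambda>\<omega>. (X \<omega>, Y \<omega>, Z \<omega>)) - entropy_of p Z"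
  unfolding cmi_def prob_space.conditional_mutual_information_def[OF measure_pmf.prob_space_axioms]
    pair_measure_countable[OF countableI_type countableI_type] UNIV_Times_UNIV
    mutual_information_pmf[OF assms]
  by simp

section \<open>Rules for conditional mutual information\<close>

text \<open>Since \<open>Q\<close> recovers the mixture index, the chain rule applies to the pair of
  the index and \<open>A\<close>.\<close>

lemma entropy_of_mixture:
  assumes "finite (set_pmf q)" "\<And>u. u \<in> set_pmf q \<Longrightarrow> finite (set_pmf (K u))"
    and Q: "\<And>u \<omega>. u \<in> set_pmf q \<Longrightarrow> \<omega> \<in> set_pmf (K u) \<Longrightarrow> Q \<omega> = u"
  shows "entropy_of (bind_pmf q K) (\<lambda>\<omega>. (Q \<omega>, A \<omega>)) =
    pmf_entropy q + (\<Sum>u\<in>set_pmf q. pmf q u * entropy_of (K u) A)"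
proof -
  have "map_pmf (\<lambda>\<omega>. (Q \<omega>, A \<omega>)) (bind_pmf q K) = bind_pmf q (\<lambda>u. map_pmf (Pair u) (map_pmf A (K u)))"
    unfolding map_bind_pmf map_pmf_comp
    by (intro bind_pmf_cong map_pmf_cong refl) (simp add: Q)
  then show ?thesis
    using assms by (simp add: pmf_entropy_bind)
qed

lemma entropy_of_pair:
  assumes "finite (set_pmf a)" "finite (set_pmf c)"
  shows "entropy_of (pair_pmf a c) (\<lambda>\<omega>. (f (fst \<omega>), g (snd \<omega>))) = entropy_of a f + entropy_of c g"
proof -
  have "(\<lambda>\<omega>. (f (fst \<omega>), g (snd \<omega>))) = (\<lambda>(a, b). (f a, g b))" by auto
  then show ?thesis using assms by (simp add: map_pair pmf_entropy_pair)
qed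

lemma cmi_cong:
  assumes "finite (set_pmf p)"
    and "\<And>\<omega> \<omega>'. X \<omega> = X \<omega>' \<longleftrightarrow> X' \<omega> = X' \<omega>'"
    and "\<And>\<omega> \<omega>'. Y \<omega> = Y \<omega>' \<longleftrightarrow> Y' \<omega> = Y' \<omega>'"
    and "\<And>\<omega> \<omega>'. Z \<omega> = Z \<omega>' \<longleftrightarrow> Z' \<omega> = Z' \<omega>'"
  shows "cmi p X Y Z = cmi p X' Y' Z'"
proof -
  have "entropy_of p (\<lambda>\<omega>. (X \<omega>, Z \<omega>)) = entropy_of p (\<lambda>\<omega>. (X' \<omega>, Z' \<omega>))"
    "entropy_of p (\<lambda>\<omega>. (Y \<omega>, Z \<omega>)) = entropy_of p (\<lambda>\<omega>. (Y' \<omega>, Z' \<omega>))"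
    "entropy_of p (\<lambda>\<omega>. (X \<omega>, Y \<omega>, Z \<omega>)) = entropy_of p (\<lambda>\<omega>. (X' \<omega>, Y' \<omega>, Z' \<omega>))"
    "entropy_of p Z = entropy_of p Z'"
    by (rule entropy_of_cong; simp add: assms)+
  then show ?thesis using assms(1) by (simp add: cmi_eq_entropy)
qed

lemma cmi_commute:
  assumes "finite (set_pmf p)"
  shows "cmi p X Y Z = cmi p Y X Z"
proof -
  have "entropy_of p (\<lambda>\<omega>. (X \<omega>, Y \<omega>, Z \<omega>)) = entropy_of p (\<lambda>\<omega>. (Y \<omega>, X \<omega>, Z \<omega>))"
    by (rule entropy_of_cong) auto
  then show ?thesis using assms by (simp add: cmi_eq_entropy)
qed

lemma cmi_map:
  assumes "finite (set_pmf p)"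
  shows "cmi (map_pmf f p) X Y Z = cmi p (\<lambda>\<omega>. X (f \<omega>)) (\<lambda>\<omega>. Y (f \<omega>)) (\<lambda>\<omega>. Z (f \<omega>))"
  using assms by (simp add: cmi_eq_entropy map_pmf_comp)

lemma cmi_chain:
  assumes "finite (set_pmf p)"
  shows "cmi p (\<lambda>\<omega>. (U \<omega>, X \<omega>)) Y Z = cmi p U Y Z + cmi p X Y (\<lambda>\<omega>. (U \<omega>, Z \<omega>))"
proof -
  have "entropy_of p (\<lambda>\<omega>. ((U \<omega>, X \<omega>), Z \<omega>)) = entropy_of p (\<lambda>\<omega>. (X \<omega>, U \<omega>, Z \<omega>))"
    "entropy_of p (\<lambda>\<omega>. ((U \<omega>, X \<omega>), Y \<omega>, Z \<omega>)) = entropy_of p (\<lambda>\<omega>. (X \<omega>, Y \<omega>, U \<omega>, Z \<omega>))"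
    "entropy_of p (\<lambda>\<omega>. (U \<omega>, Y \<omega>, Z \<omega>)) = entropy_of p (\<lambda>\<omega>. (Y \<omega>, U \<omega>, Z \<omega>))"
    by (rule entropy_of_cong; auto)+
  then show ?thesis using assms by (simp add: cmi_eq_entropy)
qed

text \<open>H(Y|X,Z) vanishes, which leaves H(Y|Z). The determinism of the channel is exploited
  through this rule.\<close>

lemma cmi_determined:
  assumes "finite (set_pmf p)"
    and "\<And>\<omega> \<omega>'. X \<omega> = X \<omega>' \<Longrightarrow> Z \<omega> = Z \<omega>' \<Longrightarrow> Y \<omega> = Y \<omega>'"
  shows "cmi p X Y Z = entropy_of p (\<lambda>\<omega>. (Y \<omega>, Z \<omega>)) - entropy_of p Z"
proof -
  have "entropy_of p (\<lambda>\<omega>. (X \<omega>, Y \<omega>, Z \<omega>)) = entropy_of p (\<lambda>\<omega>. (X \<omega>, Z \<omega>))"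
    by (rule entropy_of_cong) (auto intro: assms(2))
  then show ?thesis using assms(1) by (simp add: cmi_eq_entropy)
qed

lemma cmi_determined_by_condition:
  assumes "finite (set_pmf p)" and "\<And>\<omega> \<omega>'. Z \<omega> = Z \<omega>' \<Longrightarrow> Y \<omega> = Y \<omega>'"
  shows "cmi p X Y Z = 0"
proof -
  have "entropy_of p (\<lambda>\<omega>. (Y \<omega>, Z \<omega>)) = entropy_of p Z"
    by (rule entropy_of_cong) (auto intro: assms(2))
  then show ?thesis
    using cmi_determined[OF assms(1), of X Z Y, OF assms(2)] by simp
qed

text \<open>The entropy of the index occurs twice with each sign and cancels. The rule is applied
  both to the time-sharing variable \<open>Q\<close> and to U0.\<close>

lemma cmi_mixture:
  assumes "finite (set_pmf q)" "\<And>u. u \<in> set_pmf q \<Longrightarrow> finite (set_pmf (K u))"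
    and "\<And>u \<omega>. u \<in> set_pmf q \<Longrightarrow> \<omega> \<in> set_pmf (K u) \<Longrightarrow> Q \<omega> = u"
  shows "cmi (bind_pmf q K) X Y (\<lambda>\<omega>. (Q \<omega>, Z \<omega>)) = (\<Sum>u\<in>set_pmf q. pmf q u * cmi (K u) X Y Z)"
proof -
  note mixture = entropy_of_mixture[OF assms]
  let ?p = "bind_pmf q K"
  have fin: "finite (set_pmf ?p)" using assms by simp
  have "entropy_of ?p (\<lambda>\<omega>. (X \<omega>, Q \<omega>, Z \<omega>)) = entropy_of ?p (\<lambda>\<omega>. (Q \<omega>, X \<omega>, Z \<omega>))"
    "entropy_of ?p (\<lambda>\<omega>. (Y \<omega>, Q \<omega>, Z \<omega>)) = entropy_of ?p (\<lambda>\<omega>. (Q \<omega>, Y \<omega>, Z \<omega>))"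
    "entropy_of ?p (\<lambda>\<omega>. (X \<omega>, Y \<omega>, Q \<omega>, Z \<omega>)) = entropy_of ?p (\<lambda>\<omega>. (Q \<omega>, X \<omega>, Y \<omega>, Z \<omega>))"
    by (rule entropy_of_cong; auto)+
  moreover have "(\<Sum>u\<in>set_pmf q. pmf q u * cmi (K u) X Y Z) =
     (\<Sum>u\<in>set_pmf q. pmf q u * entropy_of (K u) (\<lambda>\<omega>. (X \<omega>, Z \<omega>))) +
     (\<Sum>u\<in>set_pmf q. pmf q u * entropy_of (K u) (\<lambda>\<omega>. (Y \<omega>, Z \<omega>))) -
     (\<Sum>u\<in>set_pmf q. pmf q u * entropy_of (K u) (\<lambda>\<omega>. (X \<omega>, Y \<omega>, Z \<omega>))) -
     (\<Sum>u\<in>set_pmf q. pmf q u * entropy_of (K u) Z)"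
    unfolding sum.distrib[symmetric] sum_subtractf[symmetric]
    by (intro sum.cong refl) (simp add: cmi_eq_entropy assms algebra_simps)
  ultimately show ?thesis
    unfolding cmi_eq_entropy[OF fin] by (simp only: mixture)
qed

lemma cmi_independent:
  assumes "finite (set_pmf a)" "finite (set_pmf c)"
  shows "cmi (pair_pmf a c) (\<lambda>\<omega>. f (fst \<omega>)) (\<lambda>\<omega>. g (snd \<omega>)) (\<lambda>\<omega>. h (snd \<omega>)) = 0"
proof -
  have fin: "finite (set_pmf (pair_pmf a c))" using assms by simp
  have "entropy_of (pair_pmf a c) (\<lambda>\<omega>. g' (snd \<omega>)) = entropy_of c g'" for g' :: "_ \<Rightarrow> 'x"
    using map_pmf_comp[of g' snd "pair_pmf a c"] by (simp add: map_snd_pair_pmf)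
  from this[of h] this[of "\<lambda>\<omega>. (g \<omega>, h \<omega>)"]
  show ?thesis
    unfolding cmi_eq_entropy[OF fin]
    using entropy_of_pair[OF assms, of f h] entropy_of_pair[OF assms, of f "\<lambda>\<omega>. (g \<omega>, h \<omega>)"]
    by simp
qed

section \<open>The Shayevitz--Wigger terms of the superposition choice\<close>

text \<open>
  In \<open>(u, t, x, s)\<close> the component \<open>x\<close> is the auxiliary that is transmitted and \<open>t\<close> the idle one:
  \<open>(U1, U2)\<close> is \<open>(x, t)\<close> for \<open>Q = 1\<close> and \<open>(t, x)\<close> for \<open>Q = 2\<close>. As \<open>U1\<close> and \<open>U2\<close> are exchangeable given
  \<open>U0\<close>, the law of \<open>(u, t, x, s)\<close> does not depend on \<open>Q\<close>.
\<close>

definition superposition_base ::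
  "'s pmf \<Rightarrow> 'u pmf \<Rightarrow> ('u \<Rightarrow> 'x pmf) \<Rightarrow> ('u \<times> 'x \<times> 'x \<times> 's) pmf" where
  "superposition_base pS pU0 K =
    bind_pmf pU0 (\<lambda>u. map_pmf (Pair u) (pair_pmf (K u) (pair_pmf (K u) pS)))"

definition superposition_outcome where
  "superposition_outcome y1 y2 q = (\<lambda>(u, t, x, s).
    let v = (if q = 1 then y2 x s else y1 x s) in
    \<lparr>rvQ = q, rvU0 = u, rvU1 = if q = 1 then x else t, rvU2 = if q = 1 then t else x, rvX = x,
       rvS = s, rvY1 = y1 x s, rvY2 = y2 x s, rvV0 = v, rvV1 = v, rvV2 = v\<rparr>)"

lemma joint_superposition:
  assumes "\<And>x s. W x s = return_pmf (y1 x s, y2 x s)"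
  shows "joint_pmf pS W (superposition_choice y1 y2 pU0 K) =
    bind_pmf (pmf_of_set {1, 2}) (\<lambda>q. map_pmf (superposition_outcome y1 y2 q) (superposition_base pS pU0 K))"
proof -
  have "bind_pmf pU0 (\<lambda>u0. bind_pmf (K u0) (\<lambda>u1. bind_pmf (K u0) (\<lambda>u2. bind_pmf pS (\<lambda>s.
      return_pmf (let x = superposition_x u0 u1 u2 q; v = (if q = 1 then y2 x s else y1 x s) in
        \<lparr>rvQ = q, rvU0 = u0, rvU1 = u1, rvU2 = u2, rvX = x,
         rvS = s, rvY1 = y1 x s, rvY2 = y2 x s, rvV0 = v, rvV1 = v, rvV2 = v\<rparr>))))) =
    map_pmf (superposition_outcome y1 y2 q) (superposition_base pS pU0 K)" for q
  proof (cases "q = 1")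
    case True
    \<comment> \<open>For \<open>Q = 1\<close> the transmitted auxiliary is U1, which is drawn
      first, whereas \<open>superposition_base\<close> draws the idle one first; the two draws from
      \<open>K u0\<close> commute.\<close>
    then show ?thesis
      by (simp add: superposition_base_def superposition_outcome_def superposition_x_def
          map_bind_pmf bind_map_pmf pair_pmf_def map_pmf_def bind_assoc_pmf bind_return_pmf)
        (rule bind_pmf_cong[OF refl], rule bind_commute_pmf)
  next
    case False
    then show ?thesis
      by (simp add: superposition_base_def superposition_outcome_def superposition_x_def
          map_bind_pmf bind_map_pmf pair_pmf_def map_pmf_def bind_assoc_pmf bind_return_pmf)
  qed
  from this[symmetric] show ?thesis
    by (simp add: joint_pmf_def superposition_choice_def assms bind_assoc_pmf bind_return_pmf Let_def)
qed

lemma finite_superposition_base: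
  fixes pS :: "'s::finite pmf" and K :: "'u \<Rightarrow> 'x::finite pmf"
  assumes "finite (set_pmf pU0)"
  shows "finite (set_pmf (superposition_base pS pU0 K))"
  using assms by (auto simp: superposition_base_def)

lemma superposition_base_marginal:
  "map_pmf (\<lambda>\<omega>. ((fst \<omega>, fst (snd (snd \<omega>))), snd (snd (snd \<omega>)))) (superposition_base pS pU0 K) =
    pair_pmf (bind_pmf pU0 (\<lambda>u. map_pmf (Pair u) (K u))) pS"
  by (simp add: superposition_base_def map_bind_pmf bind_map_pmf pair_pmf_def map_pmf_def
      bind_assoc_pmf bind_return_pmf)

text \<open>Given U0, the idle auxiliary and the pair (X, S) follow a product law, so every term of
  the average over U0 is 0.\<close>

lemma superposition_base_cond_indep:
  fixes pS :: "'s::finite pmf" and K :: "'u::countable \<Rightarrow> 'x::finite pmf"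
  assumes "finite (set_pmf pU0)"
  shows "cmi (superposition_base pS pU0 K) (\<lambda>\<omega>. fst (snd \<omega>)) (\<lambda>\<omega>. g (snd (snd \<omega>)))
      (\<lambda>\<omega>. (fst \<omega>, h (snd (snd \<omega>)))) = 0"
  unfolding superposition_base_def
  by (subst cmi_mixture) (use assms in \<open>auto simp: cmi_map cmi_independent[where f = "\<lambda>x. x"]\<close>)

text \<open>
  For \<open>Q = 1\<close> take \<open>Y = Y1\<close>, \<open>Y' = Y2\<close>, and for \<open>Q = 2\<close> the other way round; in both cases \<open>Y'\<close> is the
  common value of the \<open>V\<close>'s.
\<close>

lemma superposition_terms:
  assumes fin: "finite (set_pmf p)"
    and det_Y: "\<forall>\<omega> \<omega>'. X \<omega> = X \<omega>' \<longrightarrow> S \<omega> = S \<omega>' \<longrightarrow> Y \<omega> = Y \<omega>'"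
    and det_Y': "\<forall>\<omega> \<omega>'. X \<omega> = X \<omega>' \<longrightarrow> S \<omega> = S \<omega>' \<longrightarrow> Y' \<omega> = Y' \<omega>'"
    and det_X: "\<forall>\<omega> \<omega>'. V \<omega> = V \<omega>' \<longrightarrow> X \<omega> = X \<omega>'"
    and indep: "cmi p T Y' (\<lambda>\<omega>. (U \<omega>, S \<omega>)) = 0"
  shows "cmi p (\<lambda>\<omega>. (U \<omega>, X \<omega>)) (\<lambda>\<omega>. (Y \<omega>, Y' \<omega>)) S =
      entropy_of p (\<lambda>\<omega>. (Y \<omega>, Y' \<omega>, S \<omega>)) - entropy_of p S"
    and "cmi p V (\<lambda>\<omega>. (Y' \<omega>, Y' \<omega>)) (\<lambda>\<omega>. (Y \<omega>, S \<omega>)) =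
      entropy_of p (\<lambda>\<omega>. (Y \<omega>, Y' \<omega>, S \<omega>)) - entropy_of p (\<lambda>\<omega>. (Y \<omega>, S \<omega>))"
    and "cmi p (\<lambda>\<omega>. (U \<omega>, T \<omega>)) (\<lambda>\<omega>. (Y' \<omega>, Y' \<omega>)) S =
      entropy_of p (\<lambda>\<omega>. (Y' \<omega>, S \<omega>)) - entropy_of p S
      - entropy_of p (\<lambda>\<omega>. (U \<omega>, Y' \<omega>, S \<omega>)) + entropy_of p (\<lambda>\<omega>. (U \<omega>, S \<omega>))"
    and "cmi p V (\<lambda>\<omega>. (Y' \<omega>, Y' \<omega>)) (\<lambda>\<omega>. (Y' \<omega>, S \<omega>)) = 0"
    and "cmi p X (\<lambda>\<omega>. (Y \<omega>, Y' \<omega>)) (\<lambda>\<omega>. (U \<omega>, S \<omega>)) =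
      entropy_of p (\<lambda>\<omega>. (U \<omega>, Y \<omega>, Y' \<omega>, S \<omega>)) - entropy_of p (\<lambda>\<omega>. (U \<omega>, S \<omega>))"
    and "cmi p T (\<lambda>\<omega>. (Y' \<omega>, Y' \<omega>)) (\<lambda>\<omega>. (U \<omega>, S \<omega>)) = 0"
    and "cmi p U (\<lambda>\<omega>. (Y \<omega>, Y' \<omega>)) S =
      entropy_of p (\<lambda>\<omega>. (Y \<omega>, Y' \<omega>, S \<omega>)) - entropy_of p S
      - entropy_of p (\<lambda>\<omega>. (U \<omega>, Y \<omega>, Y' \<omega>, S \<omega>)) + entropy_of p (\<lambda>\<omega>. (U \<omega>, S \<omega>))"
    and "cmi p U (\<lambda>\<omega>. (Y' \<omega>, Y' \<omega>)) S =
      entropy_of p (\<lambda>\<omega>. (Y' \<omega>, S \<omega>)) - entropy_of p S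
      - entropy_of p (\<lambda>\<omega>. (U \<omega>, Y' \<omega>, S \<omega>)) + entropy_of p (\<lambda>\<omega>. (U \<omega>, S \<omega>))"
    and "cmi p V Y' (\<lambda>\<omega>. (Y' \<omega>, Y \<omega>, S \<omega>)) = 0"
    and "cmi p V Y' (\<lambda>\<omega>. (Y' \<omega>, Y' \<omega>, S \<omega>)) = 0"
    and "cmi p V Y' (\<lambda>\<omega>. (Y \<omega>, S \<omega>)) =
      entropy_of p (\<lambda>\<omega>. (Y \<omega>, Y' \<omega>, S \<omega>)) - entropy_of p (\<lambda>\<omega>. (Y \<omega>, S \<omega>))"
    and "cmi p V Y' (\<lambda>\<omega>. (Y' \<omega>, S \<omega>)) = 0"
proof -
  note Y = det_Y[rule_format] and Y' = det_Y'[rule_format] and V = det_X[rule_format]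
  have dup: "cmi p A (\<lambda>\<omega>. (Y' \<omega>, Y' \<omega>)) Z = cmi p A Y' Z"
    for A :: "_ \<Rightarrow> 'z::countable" and Z :: "_ \<Rightarrow> 'w::countable"
    by (rule cmi_cong) (auto simp: fin)
  have perm: "entropy_of p (\<lambda>\<omega>. ((Y \<omega>, Y' \<omega>), S \<omega>)) = entropy_of p (\<lambda>\<omega>. (Y \<omega>, Y' \<omega>, S \<omega>))"
    "entropy_of p (\<lambda>\<omega>. (Y' \<omega>, Y \<omega>, S \<omega>)) = entropy_of p (\<lambda>\<omega>. (Y \<omega>, Y' \<omega>, S \<omega>))"
    "entropy_of p (\<lambda>\<omega>. ((Y \<omega>, Y' \<omega>), U \<omega>, S \<omega>)) = entropy_of p (\<lambda>\<omega>. (U \<omega>, Y \<omega>, Y' \<omega>, S \<omega>))"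
    "entropy_of p (\<lambda>\<omega>. (U \<omega>, (Y \<omega>, Y' \<omega>), S \<omega>)) = entropy_of p (\<lambda>\<omega>. (U \<omega>, Y \<omega>, Y' \<omega>, S \<omega>))"
    by (rule entropy_of_cong; auto)+
  have VY: "Y \<omega> = Y \<omega>'" "Y' \<omega> = Y' \<omega>'" if "V \<omega> = V \<omega>'" "S \<omega> = S \<omega>'" for \<omega> \<omega>'
    by (rule Y[OF V[OF that(1)] that(2)], rule Y'[OF V[OF that(1)] that(2)])
  show "cmi p (\<lambda>\<omega>. (U \<omega>, X \<omega>)) (\<lambda>\<omega>. (Y \<omega>, Y' \<omega>)) S =
      entropy_of p (\<lambda>\<omega>. (Y \<omega>, Y' \<omega>, S \<omega>)) - entropy_of p S"
    unfolding perm(1)[symmetric] by (rule cmi_determined[OF fin]) (auto intro: Y Y')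
  show "cmi p V Y' (\<lambda>\<omega>. (Y \<omega>, S \<omega>)) =
      entropy_of p (\<lambda>\<omega>. (Y \<omega>, Y' \<omega>, S \<omega>)) - entropy_of p (\<lambda>\<omega>. (Y \<omega>, S \<omega>))"
    unfolding perm(2)[symmetric] by (rule cmi_determined[OF fin]) (auto intro: VY)
  then show "cmi p V (\<lambda>\<omega>. (Y' \<omega>, Y' \<omega>)) (\<lambda>\<omega>. (Y \<omega>, S \<omega>)) =
      entropy_of p (\<lambda>\<omega>. (Y \<omega>, Y' \<omega>, S \<omega>)) - entropy_of p (\<lambda>\<omega>. (Y \<omega>, S \<omega>))"
    by (simp add: dup)
  show "cmi p U (\<lambda>\<omega>. (Y' \<omega>, Y' \<omega>)) S =
      entropy_of p (\<lambda>\<omega>. (Y' \<omega>, S \<omega>)) - entropy_of p S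
      - entropy_of p (\<lambda>\<omega>. (U \<omega>, Y' \<omega>, S \<omega>)) + entropy_of p (\<lambda>\<omega>. (U \<omega>, S \<omega>))"
    by (simp add: dup cmi_eq_entropy[OF fin])
  then show "cmi p (\<lambda>\<omega>. (U \<omega>, T \<omega>)) (\<lambda>\<omega>. (Y' \<omega>, Y' \<omega>)) S =
      entropy_of p (\<lambda>\<omega>. (Y' \<omega>, S \<omega>)) - entropy_of p S
      - entropy_of p (\<lambda>\<omega>. (U \<omega>, Y' \<omega>, S \<omega>)) + entropy_of p (\<lambda>\<omega>. (U \<omega>, S \<omega>))"
    by (simp add: dup cmi_chain[OF fin] indep)
  show "cmi p V Y' (\<lambda>\<omega>. (Y' \<omega>, S \<omega>)) = 0"
    by (rule cmi_determined_by_condition[OF fin]) auto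
  then show "cmi p V (\<lambda>\<omega>. (Y' \<omega>, Y' \<omega>)) (\<lambda>\<omega>. (Y' \<omega>, S \<omega>)) = 0"
    by (simp add: dup)
  show "cmi p X (\<lambda>\<omega>. (Y \<omega>, Y' \<omega>)) (\<lambda>\<omega>. (U \<omega>, S \<omega>)) =
      entropy_of p (\<lambda>\<omega>. (U \<omega>, Y \<omega>, Y' \<omega>, S \<omega>)) - entropy_of p (\<lambda>\<omega>. (U \<omega>, S \<omega>))"
    unfolding perm(3)[symmetric] by (rule cmi_determined[OF fin]) (auto intro: Y Y')
  show "cmi p T (\<lambda>\<omega>. (Y' \<omega>, Y' \<omega>)) (\<lambda>\<omega>. (U \<omega>, S \<omega>)) = 0"
    by (simp add: dup indep)
  show "cmi p U (\<lambda>\<omega>. (Y \<omega>, Y' \<omega>)) S =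
      entropy_of p (\<lambda>\<omega>. (Y \<omega>, Y' \<omega>, S \<omega>)) - entropy_of p S
      - entropy_of p (\<lambda>\<omega>. (U \<omega>, Y \<omega>, Y' \<omega>, S \<omega>)) + entropy_of p (\<lambda>\<omega>. (U \<omega>, S \<omega>))"
    by (simp add: cmi_eq_entropy[OF fin] perm)
  show "cmi p V Y' (\<lambda>\<omega>. (Y' \<omega>, Y \<omega>, S \<omega>)) = 0" "cmi p V Y' (\<lambda>\<omega>. (Y' \<omega>, Y' \<omega>, S \<omega>)) = 0"
    by (rule cmi_determined_by_condition[OF fin]; simp)+
qed

section \<open>The claimed bound and the channel symmetry in entropy form\<close>

lemma symmetric_rate_bound_eq_entropy:
  fixes pS :: "'s::finite pmf" and y1 y2 :: "'x::finite \<Rightarrow> 's \<Rightarrow> 'y::finite"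
    and U :: "'w \<Rightarrow> 'u::countable"
  assumes fin: "finite (set_pmf p)"
    and law: "map_pmf (\<lambda>\<omega>. ((U \<omega>, X \<omega>), S \<omega>)) p = pair_pmf pUX pS"
  shows "symmetric_rate_bound pS y1 y2 pUX =
    (let H1 = entropy_of p (\<lambda>\<omega>. (y1 (X \<omega>) (S \<omega>), S \<omega>)); HS = entropy_of p S;
         HU1 = entropy_of p (\<lambda>\<omega>. (U \<omega>, y1 (X \<omega>) (S \<omega>), S \<omega>));
         HU12 = entropy_of p (\<lambda>\<omega>. (U \<omega>, y1 (X \<omega>) (S \<omega>), y2 (X \<omega>) (S \<omega>), S \<omega>));
         HU = entropy_of p (\<lambda>\<omega>. (U \<omega>, S \<omega>))
     in min (1/2 * (H1 - HS) + 1/4 * (HU12 - HU1)) (1/2 * (H1 - HS) + 1/2 * (H1 - HS - HU1 + HU)))"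
proof -
  let ?Y1 = "\<lambda>\<omega>. y1 (X \<omega>) (S \<omega>)" and ?Y2 = "\<lambda>\<omega>. y2 (X \<omega>) (S \<omega>)"
  have perm: "entropy_of p (\<lambda>\<omega>. (?Y2 \<omega>, ?Y1 \<omega>, U \<omega>, S \<omega>)) = entropy_of p (\<lambda>\<omega>. (U \<omega>, ?Y1 \<omega>, ?Y2 \<omega>, S \<omega>))"
    "entropy_of p (\<lambda>\<omega>. (?Y1 \<omega>, U \<omega>, S \<omega>)) = entropy_of p (\<lambda>\<omega>. (U \<omega>, ?Y1 \<omega>, S \<omega>))"
    by (rule entropy_of_cong; auto)+
  have a: "cmi p X ?Y1 S = entropy_of p (\<lambda>\<omega>. (?Y1 \<omega>, S \<omega>)) - entropy_of p S"
    by (rule cmi_determined[OF fin]) auto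
  have b: "cmi p X ?Y2 (\<lambda>\<omega>. (?Y1 \<omega>, U \<omega>, S \<omega>)) =
      entropy_of p (\<lambda>\<omega>. (U \<omega>, ?Y1 \<omega>, ?Y2 \<omega>, S \<omega>)) - entropy_of p (\<lambda>\<omega>. (U \<omega>, ?Y1 \<omega>, S \<omega>))"
    unfolding perm[symmetric] by (rule cmi_determined[OF fin]) auto
  show ?thesis
    unfolding symmetric_rate_bound_def law[symmetric] Let_def cmi_map[OF fin] prod.case
    unfolding a b cmi_eq_entropy[OF fin, of U]
    by (simp add: algebra_simps)
qed

text \<open>As \<open>A\<close> and \<open>S\<close> are independent, applying \<pi> to the state
  alone preserves their joint law, and it turns Y2 into Y1. The state component is then relabelled
  back without changing the entropy. A constant \<open>h\<close> gives the entropy of (Y1, S), and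
  \<open>h\<close> equal to U0 the one of (U0, Y1, S).\<close>

lemma symmetric_bc_entropy:
  fixes pS :: "'s::finite pmf" and W :: "'x::finite \<Rightarrow> 's \<Rightarrow> ('y::finite \<times> 'y) pmf"
  assumes "symmetric_deterministic_bc pS W y1 y2"
    and law: "map_pmf (\<lambda>\<omega>. (A \<omega>, S \<omega>)) p = pair_pmf pA pS"
  shows "entropy_of p (\<lambda>\<omega>. (h (A \<omega>), y1 (x (A \<omega>)) (S \<omega>), S \<omega>)) =
    entropy_of p (\<lambda>\<omega>. (h (A \<omega>), y2 (x (A \<omega>)) (S \<omega>), S \<omega>))"
proof -
  obtain \<pi> where \<pi>: "bij \<pi>" "\<And>s. pmf pS s = pmf pS (\<pi> s)"
    and W: "\<And>x y s. pmf (map_pmf fst (W x s)) y = pmf (map_pmf snd (W x (\<pi> s))) y"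
      "\<And>x s. W x s = return_pmf (y1 x s, y2 x s)"
    using assms(1) unfolding symmetric_deterministic_bc_def symmetric_bc_def by blast
  \<comment> \<open>Both marginals are point masses, so equal laws mean equal outputs.\<close>
  have y: "y2 x (\<pi> s) = y1 x s" for x s
  proof -
    have "return_pmf (y1 x s) = return_pmf (y2 x (\<pi> s))"
      by (rule pmf_eqI) (use W(1)[of x s] in \<open>simp add: W(2)\<close>)
    then show ?thesis by simp
  qed
  have "map_pmf \<pi> pS = pS"
  proof (rule pmf_eqI)
    fix s
    obtain s' where "s = \<pi> s'" using \<pi>(1) by (meson bij_pointE)
    then show "pmf (map_pmf \<pi> pS) s = pmf pS s"
      using \<pi>(2)[of s'] pmf_map_inj'[OF bij_is_inj[OF \<pi>(1)], of pS s'] by simp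
  qed
  then have "map_pmf (apsnd \<pi>) (pair_pmf pA pS) = pair_pmf pA pS"
    using pair_map_pmf2[of pA \<pi> pS] by simp
  then have shift: "map_pmf (\<lambda>\<omega>. (A \<omega>, \<pi> (S \<omega>))) p = map_pmf (\<lambda>\<omega>. (A \<omega>, S \<omega>)) p"
    unfolding law[symmetric] map_pmf_comp by simp
  let ?f = "\<lambda>(a, s). (h a, y2 (x a) s, s)"
  have "entropy_of p (\<lambda>\<omega>. (h (A \<omega>), y2 (x (A \<omega>)) (S \<omega>), S \<omega>)) =
      pmf_entropy (map_pmf ?f (map_pmf (\<lambda>\<omega>. (A \<omega>, S \<omega>)) p))"
    by (simp add: map_pmf_comp)
  also have "\<dots> = entropy_of p (\<lambda>\<omega>. (h (A \<omega>), y1 (x (A \<omega>)) (S \<omega>), \<pi> (S \<omega>)))"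
    unfolding shift[symmetric] by (simp add: map_pmf_comp y)
  also have "\<dots> = entropy_of p (\<lambda>\<omega>. (h (A \<omega>), y1 (x (A \<omega>)) (S \<omega>), S \<omega>))"
    by (rule entropy_of_cong) (simp add: inj_eq[OF bij_is_inj[OF \<pi>(1)]])
  finally show ?thesis by simp
qed

text \<open>By symmetry the two arguments of the \<open>min\<close> and those of the
  \<open>max\<close> in the third inequality agree, so at R1 = R2 = R this inequality yields the
  first term of the bound. The individual inequalities and the fourth all yield the second
  term.\<close>

lemma shayevitz_wigger_superposition_iff:
  fixes pS :: "'s::finite pmf" and W :: "'x::finite \<Rightarrow> 's \<Rightarrow> ('y::finite \<times> 'y) pmf"
    and pU0 :: "'u::countable pmf"
  assumes bc: "symmetric_deterministic_bc pS W y1 y2" and finU: "finite (set_pmf pU0)"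
  shows "shayevitz_wigger (joint_pmf pS W (superposition_choice y1 y2 pU0 K)) R R \<longleftrightarrow>
    0 \<le> R \<and> R \<le> symmetric_rate_bound pS y1 y2 (bind_pmf pU0 (\<lambda>u. map_pmf (Pair u) (K u)))"
proof -
  have W: "\<And>x s. W x s = return_pmf (y1 x s, y2 x s)"
    using bc unfolding symmetric_deterministic_bc_def by blast
  define p where "p = superposition_base pS pU0 K"
  define U :: "'u \<times> 'x \<times> 'x \<times> 's \<Rightarrow> 'u" where "U = fst"
  define T :: "'u \<times> 'x \<times> 'x \<times> 's \<Rightarrow> 'x" where "T = (\<lambda>\<omega>. fst (snd \<omega>))"
  define X :: "'u \<times> 'x \<times> 'x \<times> 's \<Rightarrow> 'x" where "X = (\<lambda>\<omega>. fst (snd (snd \<omega>)))"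
  define S :: "'u \<times> 'x \<times> 'x \<times> 's \<Rightarrow> 's" where "S = (\<lambda>\<omega>. snd (snd (snd \<omega>)))"
  define Y1 where "Y1 = (\<lambda>\<omega>. y1 (X \<omega>) (S \<omega>))"
  define Y2 where "Y2 = (\<lambda>\<omega>. y2 (X \<omega>) (S \<omega>))"
  note rv_defs = U_def T_def X_def S_def Y1_def Y2_def
  have fin: "finite (set_pmf p)"
    unfolding p_def by (rule finite_superposition_base[OF finU])
  have law: "map_pmf (\<lambda>\<omega>. ((U \<omega>, X \<omega>), S \<omega>)) p =
      pair_pmf (bind_pmf pU0 (\<lambda>u. map_pmf (Pair u) (K u))) pS"
    unfolding p_def rv_defs by (rule superposition_base_marginal)
  have indep: "cmi p T Y1 (\<lambda>\<omega>. (U \<omega>, S \<omega>)) = 0" "cmi p T Y2 (\<lambda>\<omega>. (U \<omega>, S \<omega>)) = 0"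
    unfolding p_def rv_defs
    by (rule superposition_base_cond_indep[OF finU, of pS K "\<lambda>\<omega>. y1 (fst \<omega>) (snd \<omega>)" snd]
        superposition_base_cond_indep[OF finU, of pS K "\<lambda>\<omega>. y2 (fst \<omega>) (snd \<omega>)" snd])+
  have TX: "cmi p T X U = 0"
  proof -
    \<comment> \<open>A constant component brings the condition into the shape required by
      \<open>superposition_base_cond_indep\<close>.\<close>
    have "cmi p T X U = cmi p T X (\<lambda>\<omega>. (U \<omega>, ()))"
      by (rule cmi_cong[OF fin]) auto
    also have "\<dots> = 0"
      unfolding p_def rv_defs by (rule superposition_base_cond_indep[OF finU])
    finally show ?thesis .
  qed
  then have XT: "cmi p X T U = 0"
    using cmi_commute[OF fin, of X T U] by simp
  have Y2S: "entropy_of p (\<lambda>\<omega>. (Y2 \<omega>, S \<omega>)) = entropy_of p (\<lambda>\<omega>. (Y1 \<omega>, S \<omega>))"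
  proof -
    \<comment> \<open>The dummy component fills the slot of \<open>h\<close> in
      \<open>symmetric_bc_entropy\<close>.\<close>
    have *: "entropy_of p (\<lambda>\<omega>. (Y1 \<omega>, S \<omega>)) = entropy_of p (\<lambda>\<omega>. ((), Y1 \<omega>, S \<omega>))"
      "entropy_of p (\<lambda>\<omega>. (Y2 \<omega>, S \<omega>)) = entropy_of p (\<lambda>\<omega>. ((), Y2 \<omega>, S \<omega>))"
      by (rule entropy_of_cong; auto)+
    show ?thesis
      using symmetric_bc_entropy[OF bc law, of "\<lambda>_. ()" snd] * by (simp add: Y1_def Y2_def)
  qed
  have UY2S: "entropy_of p (\<lambda>\<omega>. (U \<omega>, Y2 \<omega>, S \<omega>)) = entropy_of p (\<lambda>\<omega>. (U \<omega>, Y1 \<omega>, S \<omega>))"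
    using symmetric_bc_entropy[OF bc law, of fst snd] unfolding Y1_def Y2_def by simp
  have perm: "entropy_of p (\<lambda>\<omega>. (Y2 \<omega>, Y1 \<omega>, S \<omega>)) = entropy_of p (\<lambda>\<omega>. (Y1 \<omega>, Y2 \<omega>, S \<omega>))"
    "entropy_of p (\<lambda>\<omega>. (U \<omega>, Y2 \<omega>, Y1 \<omega>, S \<omega>)) = entropy_of p (\<lambda>\<omega>. (U \<omega>, Y1 \<omega>, Y2 \<omega>, S \<omega>))"
    by (rule entropy_of_cong; auto)+
  \<comment> \<open>Every condition contains \<open>Q\<close>, whose two values have probability
    1/2, so each term is the mean of its values for \<open>Q = 1\<close> and
    \<open>Q = 2\<close>.\<close>
  have split: "cmi (joint_pmf pS W (superposition_choice y1 y2 pU0 K)) A B (\<lambda>\<omega>. (rvQ \<omega>, Z \<omega>)) =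
      (cmi p (\<lambda>\<omega>. A (superposition_outcome y1 y2 1 \<omega>)) (\<lambda>\<omega>. B (superposition_outcome y1 y2 1 \<omega>))
        (\<lambda>\<omega>. Z (superposition_outcome y1 y2 1 \<omega>)) +
       cmi p (\<lambda>\<omega>. A (superposition_outcome y1 y2 2 \<omega>)) (\<lambda>\<omega>. B (superposition_outcome y1 y2 2 \<omega>))
        (\<lambda>\<omega>. Z (superposition_outcome y1 y2 2 \<omega>))) / 2"
    for A :: "_ \<Rightarrow> 'a::countable" and B :: "_ \<Rightarrow> 'b::countable" and Z :: "_ \<Rightarrow> 'c::countable"
    unfolding joint_superposition[OF W] p_def[symmetric]
    by (subst cmi_mixture)
      (auto simp: fin cmi_map superposition_outcome_def Let_def add_divide_distrib)
  have out: "superposition_outcome y1 y2 (1 :: nat) \<omega> = \<lparr>rvQ = 1, rvU0 = U \<omega>, rvU1 = X \<omega>, rvU2 = T \<omega>, rvX = X \<omega>,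
       rvS = S \<omega>, rvY1 = Y1 \<omega>, rvY2 = Y2 \<omega>, rvV0 = Y2 \<omega>, rvV1 = Y2 \<omega>, rvV2 = Y2 \<omega>\<rparr>"
    "superposition_outcome y1 y2 (2 :: nat) \<omega> = \<lparr>rvQ = 2, rvU0 = U \<omega>, rvU1 = T \<omega>, rvU2 = X \<omega>, rvX = X \<omega>,
       rvS = S \<omega>, rvY1 = Y1 \<omega>, rvY2 = Y2 \<omega>, rvV0 = Y1 \<omega>, rvV1 = Y1 \<omega>, rvV2 = Y1 \<omega>\<rparr>" for \<omega>
    by (auto simp: superposition_outcome_def rv_defs Let_def split: prod.splits)
  have det: "\<forall>\<omega> \<omega>'. X \<omega> = X \<omega>' \<longrightarrow> S \<omega> = S \<omega>' \<longrightarrow> Y1 \<omega> = Y1 \<omega>'"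
    "\<forall>\<omega> \<omega>'. X \<omega> = X \<omega>' \<longrightarrow> S \<omega> = S \<omega>' \<longrightarrow> Y2 \<omega> = Y2 \<omega>'"
    by (simp_all add: Y1_def Y2_def)
  \<comment> \<open>The triple (U0, U1, U2) has the transmitted auxiliary in second place for
    \<open>Q = 1\<close> and in third place for \<open>Q = 2\<close>.\<close>
  have det': "\<forall>\<omega> \<omega>'. (U \<omega>, X \<omega>, T \<omega>) = (U \<omega>', X \<omega>', T \<omega>') \<longrightarrow> X \<omega> = X \<omega>'"
    "\<forall>\<omega> \<omega>'. (U \<omega>, T \<omega>, X \<omega>) = (U \<omega>', T \<omega>', X \<omega>') \<longrightarrow> X \<omega> = X \<omega>'"
    by simp_all
  have Y_app: "y1 (X \<omega>) (S \<omega>) = Y1 \<omega>" "y2 (X \<omega>) (S \<omega>) = Y2 \<omega>" for \<omega>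
    by (simp_all add: Y1_def Y2_def)
  note vals = superposition_terms[OF fin det(1) det(2) det'(1) indep(2)]
    superposition_terms[OF fin det(2) det(1) det'(2) indep(1)] TX XT
  show ?thesis
    unfolding shayevitz_wigger_def Let_def split out outcome.simps
      symmetric_rate_bound_eq_entropy[OF fin law, of y1 y2] Y_app
    unfolding vals perm Y2S UY2S
    by (auto simp: field_simps min_def)
qed

section \<open>Attainment of the maximum\<close>

lemma ex_pmf_finite:
  fixes u :: "'a \<Rightarrow> real"
  assumes "finite A" "\<And>i. i \<in> A \<Longrightarrow> 0 \<le> u i" "sum u A = 1"
  shows "\<exists>p. \<forall>i. pmf p i = (if i \<in> A then u i else 0)"
proof -
  let ?f = "\<lambda>i. if i \<in> A then u i else 0"
  have "(\<integral>\<^sup>+ i. ennreal (?f i) \<partial>count_space UNIV) = (\<Sum>i\<in>A. ennreal (?f i))"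
    by (rule nn_integral_count_space') (use assms(1) in auto)
  also have "\<dots> = ennreal (\<Sum>i\<in>A. u i)"
    using assms(2) by (subst sum_ennreal[symmetric]) auto
  finally have "(\<integral>\<^sup>+ i. ennreal (?f i) \<partial>count_space UNIV) = 1"
    using assms(3) by simp
  then have "pmf (embed_pmf ?f) i = ?f i" for i
    by (intro pmf_embed_pmf) (auto simp: assms(2))
  then show ?thesis by blast
qed

text \<open>Factorisation p(u0,x) = p(u0) p(x|u0). Through it the pairs of \<open>pU0\<close> and
  \<open>K\<close> in the superposition choices reach every joint law of (U0, X).\<close>

lemma pmf_disintegration:
  fixes p :: "('a \<times> 'b) pmf"
  shows "bind_pmf (map_pmf fst p) (\<lambda>u. map_pmf (Pair u) (map_pmf snd (cond_pmf p {\<omega>. fst \<omega> = u}))) = p"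
proof -
  have ne: "set_pmf p \<inter> {\<omega>. fst \<omega> = u} \<noteq> {}" if "u \<in> set_pmf (map_pmf fst p)" for u
    using that by auto
  have "bind_pmf (map_pmf fst p) (\<lambda>u. map_pmf (Pair u) (map_pmf snd (cond_pmf p {\<omega>. fst \<omega> = u}))) =
    bind_pmf (map_pmf fst p) (\<lambda>u. cond_pmf p {\<omega>. fst \<omega> = u})"
  proof (rule bind_pmf_cong[OF refl])
    fix u assume "u \<in> set_pmf (map_pmf fst p)"
    then have "set_pmf (cond_pmf p {\<omega>. fst \<omega> = u}) \<subseteq> {\<omega>. fst \<omega> = u}"
      using set_cond_pmf[OF ne] by auto
    then have "map_pmf (\<lambda>\<omega>. (u, snd \<omega>)) (cond_pmf p {\<omega>. fst \<omega> = u}) =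
      map_pmf (\<lambda>\<omega>. \<omega>) (cond_pmf p {\<omega>. fst \<omega> = u})"
      by (intro map_pmf_cong refl) auto
    then show "map_pmf (Pair u) (map_pmf snd (cond_pmf p {\<omega>. fst \<omega> = u})) = cond_pmf p {\<omega>. fst \<omega> = u}"
      by (simp add: map_pmf_comp)
  qed
  also have "\<dots> = p"
  proof (rule bind_cond_pmf_cancel)
    fix u and y :: "'a \<times> 'b" assume "fst y = u"
    then have "{u'. fst y = u'} = {u}" by auto
    then show "measure_pmf.prob p {y. fst y = u} = measure_pmf.prob (map_pmf fst p) {u. fst y = u}"
      by (simp add: vimage_def)
  qed (use ne in auto)
  finally show ?thesis .
qed

section \<open>The probability simplex and continuity of entropy\<close>

text \<open>Places the pmfs in a Euclidean space, where they form the probability simplex, to make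
  compactness and convex hulls available.\<close>

definition pmf_vec :: "'x::finite pmf \<Rightarrow> real ^ 'x" where
  "pmf_vec k = (\<chi> x. pmf k x)"

lemma range_pmf_vec: "range pmf_vec = {v. (\<forall>x. 0 \<le> v $ x) \<and> (\<Sum>x\<in>UNIV. v $ x) = 1}"
proof (intro equalityI subsetI)
  fix v :: "real ^ 'x" assume "v \<in> {v. (\<forall>x. 0 \<le> v $ x) \<and> (\<Sum>x\<in>UNIV. v $ x) = 1}"
  then obtain k where "\<And>x. pmf k x = v $ x"
    using ex_pmf_finite[of UNIV "\<lambda>x. v $ x"] by auto
  then have "v = pmf_vec k" by (simp add: pmf_vec_def vec_eq_iff)
  then show "v \<in> range pmf_vec" by simp
qed (auto simp: pmf_vec_def sum_pmf_eq_1)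

lemma compact_range_pmf_vec: "compact (range (pmf_vec :: 'x::finite pmf \<Rightarrow> _))"
proof -
  have "range (pmf_vec :: 'x pmf \<Rightarrow> _) = {v. (\<Sum>x\<in>UNIV. v $ x) = 1} \<inter> cbox 0 1"
    unfolding range_pmf_vec
  proof (intro equalityI subsetI)
    fix v :: "real ^ 'x" assume v: "v \<in> {v. (\<forall>x. 0 \<le> v $ x) \<and> (\<Sum>x\<in>UNIV. v $ x) = 1}"
    have "v $ x \<le> 1" for x
      using v member_le_sum[of x UNIV "\<lambda>x. v $ x"] by simp
    with v show "v \<in> {v. (\<Sum>x\<in>UNIV. v $ x) = 1} \<inter> cbox 0 1"
      by (simp add: mem_box_cart)
  qed (auto simp: mem_box_cart)
  moreover have "closed {v :: real ^ 'x. (\<Sum>x\<in>UNIV. v $ x) = 1}"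
    by (intro closed_Collect_eq continuous_intros)
  ultimately show ?thesis
    by (metis closed_Int_compact compact_cbox)
qed

lemma convex_range_pmf_vec: "convex (range pmf_vec)"
  unfolding range_pmf_vec convex_def
  by (auto simp: sum.distrib sum_distrib_left[symmetric])

text \<open>Only 0 is delicate: there t log t tends to 0, which is also the value of the product at
  0.\<close>

lemma continuous_on_mult_log: "continuous_on {0..} (\<lambda>t::real. t * log 2 t)"
proof -
  have "((\<lambda>t::real. t * log 2 t) \<longlongrightarrow> 0) (at_right 0)"
    by real_asymp
  then have "((\<lambda>t::real. t * log 2 t) \<longlongrightarrow> 0 * log 2 0) (at 0 within {0..})"
    by (simp add: at_within_Ici_at_right)
  moreover have "((\<lambda>t::real. t * log 2 t) \<longlongrightarrow> a * log 2 a) (at a within {0..})" if "a > 0" for a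
    using that by (intro tendsto_intros) auto
  ultimately show ?thesis
    unfolding continuous_on_def by (metis atLeast_iff order_le_less)
qed

text \<open>For \<open>v\<close> in the simplex this is the entropy of \<open>Z (X, S)\<close> with
  X distributed as \<open>v\<close> and independent of S. As a formula in a vector it can be tested
  for continuity; outputs of mass 0 contribute 0.\<close>

definition channel_entropy :: "'s::finite pmf \<Rightarrow> ('x::finite \<times> 's \<Rightarrow> 'z::finite) \<Rightarrow> real ^ 'x \<Rightarrow> real" where
  "channel_entropy pS Z v = (\<Sum>z\<in>UNIV.
     - ((\<Sum>x\<in>UNIV. v $ x * pmf (map_pmf (\<lambda>s. Z (x, s)) pS) z) *
        log 2 (\<Sum>x\<in>UNIV. v $ x * pmf (map_pmf (\<lambda>s. Z (x, s)) pS) z)))"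

lemma pmf_bind_finite:
  assumes "finite (set_pmf q)"
  shows "pmf (bind_pmf q K) z = (\<Sum>u\<in>set_pmf q. pmf q u * pmf (K u) z)"
  unfolding pmf_bind by (subst integral_measure_pmf_real[OF assms]) (auto simp: mult.commute)

lemma entropy_of_pair_eq_channel_entropy:
  "entropy_of (pair_pmf k pS) Z = channel_entropy pS Z (pmf_vec k)"
proof -
  have "map_pmf Z (pair_pmf k pS) = bind_pmf k (\<lambda>x. map_pmf (\<lambda>s. Z (x, s)) pS)"
    by (simp add: pair_pmf_def map_bind_pmf map_pmf_def bind_assoc_pmf bind_return_pmf)
  moreover have "pmf (bind_pmf k (\<lambda>x. map_pmf (\<lambda>s. Z (x, s)) pS)) z =
      (\<Sum>x\<in>UNIV. pmf_vec k $ x * pmf (map_pmf (\<lambda>s. Z (x, s)) pS) z)" for z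
    unfolding pmf_bind pmf_vec_def
    by (subst integral_measure_pmf_real[of UNIV]) (auto simp: mult.commute)
  ultimately have "channel_entropy pS Z (pmf_vec k) =
      (\<Sum>z\<in>UNIV. - (pmf (map_pmf Z (pair_pmf k pS)) z * log 2 (pmf (map_pmf Z (pair_pmf k pS)) z)))"
    by (simp add: channel_entropy_def)
  also have "\<dots> = entropy_of (pair_pmf k pS) Z"
    unfolding pmf_entropy_def
    by (rule sum.mono_neutral_right) (auto simp: pmf_eq_0_set_pmf simp del: set_map_pmf)
  finally show ?thesis by simp
qed

text \<open>The output masses are linear in \<open>v\<close> and nonnegative on the simplex, so they
  stay where t log t is continuous.\<close>

lemma continuous_on_channel_entropy: "continuous_on (range pmf_vec) (channel_entropy pS Z)"
  unfolding channel_entropy_def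
  by (intro continuous_on_sum continuous_on_minus
      continuous_on_compose2[OF continuous_on_mult_log] continuous_intros)
    (auto simp: range_pmf_vec intro!: sum_nonneg)

section \<open>The rate as a continuous function on a compact convex set\<close>

context
  fixes pS :: "'s::finite pmf" and y1 y2 :: "'x::finite \<Rightarrow> 's \<Rightarrow> 'y::finite"
begin

abbreviation H1 :: "real ^ 'x \<Rightarrow> real" where
  "H1 \<equiv> channel_entropy pS (\<lambda>(x, s). (y1 x s, s))"

abbreviation H12 :: "real ^ 'x \<Rightarrow> real" where
  "H12 \<equiv> channel_entropy pS (\<lambda>(x, s). (y1 x s, y2 x s, s))"

text \<open>
  The bound depends on \<open>p(u0, x)\<close> only through a convex combination, with weights \<open>p(u0)\<close>, of points of
  this compact graph. This replaces a cardinality bound on the alphabet of \<open>U0\<close>.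
\<close>

definition rate_graph :: "((real ^ 'x) \<times> real \<times> real) set" where
  "rate_graph = (\<lambda>v. (v, H1 v, H12 v)) ` range pmf_vec"

text \<open>Here \<open>v\<close> stands for p(x), \<open>a\<close> for H(Y1,S|U0) and
  \<open>c\<close> for H(Y1,Y2,S|U0). Thus \<open>c - a\<close> is H(Y2|Y1,U0,S), and
  \<open>H1 v - a\<close> is I(U0;Y1|S) because U0 and S are independent.\<close>

definition rate_value :: "(real ^ 'x) \<times> real \<times> real \<Rightarrow> real" where
  "rate_value = (\<lambda>(v, a, c). min (1/2 * (H1 v - pmf_entropy pS) + 1/4 * (c - a))
     (1/2 * (H1 v - pmf_entropy pS) + 1/2 * (H1 v - a)))"

text \<open>H(U0) is contained in the entropies of (U0,S), (U0,Y1,S) and (U0,Y1,Y2,S) and cancels in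
  their differences. What remains are averages over U0, and p(x) is itself the average of the
  kernels.\<close>

lemma symmetric_rate_bound_eq_rate_value:
  fixes K :: "'u::countable \<Rightarrow> 'x pmf"
  assumes fin: "finite (set_pmf pU0)"
  shows "symmetric_rate_bound pS y1 y2 (bind_pmf pU0 (\<lambda>u. map_pmf (Pair u) (K u))) =
    rate_value (\<Sum>u\<in>set_pmf pU0. pmf pU0 u *\<^sub>R (pmf_vec (K u), H1 (pmf_vec (K u)), H12 (pmf_vec (K u))))"
proof -
  define p where "p = pair_pmf (bind_pmf pU0 (\<lambda>u. map_pmf (Pair u) (K u))) pS"
  have p: "p = bind_pmf pU0 (\<lambda>u. map_pmf (\<lambda>(x, s). ((u, x), s)) (pair_pmf (K u) pS))"
    by (simp add: p_def pair_pmf_def map_pmf_def bind_assoc_pmf bind_return_pmf)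
  have finp: "finite (set_pmf p)"
    using fin by (simp add: p_def)
  have law: "map_pmf (\<lambda>\<omega>. ((fst (fst \<omega>), snd (fst \<omega>)), snd \<omega>)) p =
      pair_pmf (bind_pmf pU0 (\<lambda>u. map_pmf (Pair u) (K u))) pS"
    by (simp add: p_def)
  have mixture: "entropy_of p (\<lambda>\<omega>. (fst (fst \<omega>), A (snd (fst \<omega>)) (snd \<omega>))) =
      pmf_entropy pU0 + (\<Sum>u\<in>set_pmf pU0. pmf pU0 u * entropy_of (pair_pmf (K u) pS) (\<lambda>(x, s). A x s))"
    for A :: "'x \<Rightarrow> 's \<Rightarrow> 'z"
    unfolding p
    by (subst entropy_of_mixture) (auto simp: fin map_pmf_comp case_prod_unfold)
  have HU: "entropy_of p (\<lambda>\<omega>. (fst (fst \<omega>), snd \<omega>)) = pmf_entropy pU0 + pmf_entropy pS"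
    using mixture[of "\<lambda>x s. s"] fin
    by (simp add: case_prod_unfold map_snd_pair_pmf sum_distrib_right[symmetric] sum_pmf_eq_1)
  have HS: "entropy_of p snd = pmf_entropy pS"
    by (simp add: p_def map_snd_pair_pmf)
  have marginal: "map_pmf (\<lambda>\<omega>. (snd (fst \<omega>), snd \<omega>)) p = pair_pmf (bind_pmf pU0 K) pS"
    by (simp add: p_def pair_pmf_def map_pmf_def bind_assoc_pmf bind_return_pmf)
  have H1: "entropy_of p (\<lambda>\<omega>. (y1 (snd (fst \<omega>)) (snd \<omega>), snd \<omega>)) = H1 (pmf_vec (bind_pmf pU0 K))"
    unfolding entropy_of_pair_eq_channel_entropy[symmetric] marginal[symmetric] map_pmf_comp by simp
  have vec: "(\<Sum>u\<in>set_pmf pU0. pmf pU0 u *\<^sub>R pmf_vec (K u)) = pmf_vec (bind_pmf pU0 K)"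
    using fin by (simp add: pmf_vec_def vec_eq_iff pmf_bind_finite)
  have sum: "(\<Sum>u\<in>set_pmf pU0. pmf pU0 u *\<^sub>R (pmf_vec (K u), H1 (pmf_vec (K u)), H12 (pmf_vec (K u)))) =
    (pmf_vec (bind_pmf pU0 K), \<Sum>u\<in>set_pmf pU0. pmf pU0 u * H1 (pmf_vec (K u)),
      \<Sum>u\<in>set_pmf pU0. pmf pU0 u * H12 (pmf_vec (K u)))"
    unfolding vec[symmetric] by (simp add: prod_eq_iff fst_sum snd_sum)
  have HU1: "entropy_of p (\<lambda>\<omega>. (fst (fst \<omega>), y1 (snd (fst \<omega>)) (snd \<omega>), snd \<omega>)) =
      pmf_entropy pU0 + (\<Sum>u\<in>set_pmf pU0. pmf pU0 u * H1 (pmf_vec (K u)))"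
    unfolding entropy_of_pair_eq_channel_entropy[symmetric] by (rule mixture)
  have HU12: "entropy_of p (\<lambda>\<omega>. (fst (fst \<omega>), y1 (snd (fst \<omega>)) (snd \<omega>), y2 (snd (fst \<omega>)) (snd \<omega>), snd \<omega>)) =
      pmf_entropy pU0 + (\<Sum>u\<in>set_pmf pU0. pmf pU0 u * H12 (pmf_vec (K u)))"
    unfolding entropy_of_pair_eq_channel_entropy[symmetric] by (rule mixture)
  show ?thesis
    unfolding symmetric_rate_bound_eq_entropy[OF finp law] Let_def HU HS H1 HU1 HU12 sum rate_value_def prod.case
    by (simp add: algebra_simps)
qed

text \<open>In finite dimension the convex hull of a compact set is compact, so a continuous
  function attains its supremum on it.\<close>

lemma rate_value_attains_max:
  "\<exists>z\<in>convex hull rate_graph. \<forall>z'\<in>convex hull rate_graph. rate_value z' \<le> rate_value z"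
proof -
  have "compact rate_graph"
    unfolding rate_graph_def
    by (intro compact_continuous_image compact_range_pmf_vec continuous_on_Pair
        continuous_on_id continuous_on_channel_entropy)
  then have compact: "compact (convex hull rate_graph)"
    by (rule compact_convex_hull)
  \<comment> \<open>Continuity of \<open>H1\<close> is available on the simplex; the first
    coordinate stays there because the simplex is convex.\<close>
  have "convex hull rate_graph \<subseteq> range pmf_vec \<times> UNIV"
    by (rule hull_minimal) (auto simp: rate_graph_def intro!: convex_Times convex_range_pmf_vec)
  then have "fst ` (convex hull rate_graph) \<subseteq> range pmf_vec"
    by auto
  then have "continuous_on (convex hull rate_graph) rate_value"
    unfolding rate_value_def split_beta
    by (intro continuous_intros continuous_on_compose2[OF continuous_on_channel_entropy])
  moreover have "convex hull rate_graph \<noteq> {}"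
    by (simp add: rate_graph_def)
  ultimately show ?thesis
    using continuous_attains_sup[OF compact] by blast
qed

text \<open>The index of a convex combination becomes the value of U0, its weight becomes p(u0), and
  the pmf behind its graph point becomes the kernel at u0.\<close>

lemma rate_graph_hull_eq_sum:
  assumes "z \<in> convex hull rate_graph"
  shows "\<exists>(pU0 :: nat pmf) K. finite (set_pmf pU0) \<and>
    z = (\<Sum>u\<in>set_pmf pU0. pmf pU0 u *\<^sub>R (pmf_vec (K u), H1 (pmf_vec (K u)), H12 (pmf_vec (K u))))"
proof -
  obtain k :: nat and u x where ux: "\<And>i. i \<in> {1..k} \<Longrightarrow> 0 \<le> u i \<and> x i \<in> rate_graph"
    and u: "sum u {1..k} = 1" and z: "(\<Sum>i = 1..k. u i *\<^sub>R x i) = z"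
    using assms unfolding convex_hull_indexed by blast
  obtain pU0 where pU0: "\<And>i. pmf pU0 i = (if i \<in> {1..k} then u i else 0)"
    using ex_pmf_finite[of "{1..k}" u] ux u by blast
  have "\<forall>i\<in>{1..k}. \<exists>q. x i = (pmf_vec q, H1 (pmf_vec q), H12 (pmf_vec q))"
    using ux unfolding rate_graph_def by fast
  from bchoice[OF this] obtain K
    where K: "\<forall>i\<in>{1..k}. x i = (pmf_vec (K i), H1 (pmf_vec (K i)), H12 (pmf_vec (K i)))" by blast
  \<comment> \<open>Indices of weight 0 leave the support, and their summands vanish.\<close>
  have sub: "set_pmf pU0 \<subseteq> {1..k}"
    by (auto simp: set_pmf_eq pU0 split: if_splits)
  have "z = (\<Sum>i = 1..k. pmf pU0 i *\<^sub>R (pmf_vec (K i), H1 (pmf_vec (K i)), H12 (pmf_vec (K i))))"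
    unfolding z[symmetric] by (intro sum.cong refl) (simp add: pU0 K)
  also have "\<dots> = (\<Sum>i\<in>set_pmf pU0. pmf pU0 i *\<^sub>R (pmf_vec (K i), H1 (pmf_vec (K i)), H12 (pmf_vec (K i))))"
    by (rule sum.mono_neutral_right) (use sub in \<open>auto simp: set_pmf_eq zero_prod_def\<close>)
  finally show ?thesis
    using finite_subset[OF sub] by blast
qed

lemma sum_mem_rate_graph_hull:
  assumes "finite (set_pmf pU0)"
  shows "(\<Sum>u\<in>set_pmf pU0. pmf pU0 u *\<^sub>R (pmf_vec (K u), H1 (pmf_vec (K u)), H12 (pmf_vec (K u))))
    \<in> convex hull rate_graph"
  using assms
  by (intro convex_sum convex_convex_hull hull_inc) (auto simp: sum_pmf_eq_1 rate_graph_def)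

end

section \<open>The supremum as a maximum\<close>

text \<open>\<open>Q\<close> has two values, U1 and U2 range over a finite type and the V's are
  point masses, so finiteness is decided by U0.\<close>

lemma finite_alphabets_superposition_iff:
  fixes K :: "'u \<Rightarrow> 'x::finite pmf"
  shows "finite_alphabets (superposition_choice y1 y2 pU0 K) \<longleftrightarrow> finite (set_pmf pU0)"
proof
  assume "finite_alphabets (superposition_choice y1 y2 pU0 K)"
  then have "finite (fst ` set_pmf (aux_pU (superposition_choice y1 y2 pU0 K) 0))"
    by (simp add: finite_alphabets_def)
  also have "fst ` set_pmf (aux_pU (superposition_choice y1 y2 pU0 K) 0) = set_pmf pU0"
    by (auto simp: superposition_choice_def image_UN set_pmf_not_empty)
  finally show "finite (set_pmf pU0)" .
qed (auto simp: finite_alphabets_def superposition_choice_def Let_def)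

text \<open>The maximum is expressed as an upper bound that is attained; \<open>nat\<close>
  accommodates every finite alphabet of U0.\<close>

theorem proposition2:
  fixes pS :: "'s::finite pmf"
    and W :: "'x::finite \<Rightarrow> 's \<Rightarrow> ('y::finite \<times> 'y) pmf"
    and y1 y2 :: "'x \<Rightarrow> 's \<Rightarrow> 'y"
  assumes "symmetric_deterministic_bc pS W y1 y2"
  shows "(\<exists>pUX :: (nat \<times> 'x) pmf. finite (set_pmf pUX) \<and>
            R_sym_sp pS W y1 y2 = symmetric_rate_bound pS y1 y2 pUX) \<and>
         (\<forall>pUX :: (nat \<times> 'x) pmf. finite (set_pmf pUX) \<longrightarrow>
            symmetric_rate_bound pS y1 y2 pUX \<le> R_sym_sp pS W y1 y2)"
proof -
  let ?B = "symmetric_rate_bound pS y1 y2 :: (nat \<times> 'x) pmf \<Rightarrow> real"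
  let ?join = "\<lambda>(pU0 :: nat pmf) (K :: nat \<Rightarrow> 'x pmf). bind_pmf pU0 (\<lambda>u. map_pmf (Pair u) (K u))"
  let ?S = "{R. \<exists>(pU0 :: nat pmf) K. finite_alphabets (superposition_choice y1 y2 pU0 K) \<and>
            shayevitz_wigger (joint_pmf pS W (superposition_choice y1 y2 pU0 K)) R R}"
  obtain z where z: "z \<in> convex hull rate_graph pS y1 y2"
    and max: "\<And>z'. z' \<in> convex hull rate_graph pS y1 y2 \<Longrightarrow> rate_value pS y1 z' \<le> rate_value pS y1 z"
    using rate_value_attains_max[of pS y1 y2] by blast
  obtain pU0 :: "nat pmf" and K where finU: "finite (set_pmf pU0)"
    and z_eq: "z = (\<Sum>u\<in>set_pmf pU0. pmf pU0 u *\<^sub>R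
      (pmf_vec (K u), H1 pS y1 (pmf_vec (K u)), H12 pS y1 y2 (pmf_vec (K u))))"
    using rate_graph_hull_eq_sum[OF z] by blast
  have eq: "rate_value pS y1 z = ?B (?join pU0 K)"
    unfolding z_eq by (rule symmetric_rate_bound_eq_rate_value[OF finU, symmetric])
  have le: "?B (?join q L) \<le> ?B (?join pU0 K)" if "finite (set_pmf q)" for q L
    unfolding eq[symmetric] symmetric_rate_bound_eq_rate_value[OF that]
    by (intro max sum_mem_rate_graph_hull that)
  \<comment> \<open>The maximal value can only belong to \<open>?S\<close> if it is nonnegative. It
    is compared with a constant U0 and a constant input \<open>x\<close>, an arbitrary letter: all
    entropies then reduce to H(S) and the bound is 0.\<close>
  have nonneg: "0 \<le> ?B (?join pU0 K)"
  proof -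
    obtain x :: 'x where True by simp
    have "channel_entropy pS (\<lambda>(x, s). (y1 x s, s)) (pmf_vec (return_pmf x)) = pmf_entropy pS"
      "channel_entropy pS (\<lambda>(x, s). (y1 x s, y2 x s, s)) (pmf_vec (return_pmf x)) = pmf_entropy pS"
      unfolding entropy_of_pair_eq_channel_entropy[symmetric] pair_return_pmf1 map_pmf_comp prod.case
      by (rule pmf_entropy_map_inj, simp add: inj_on_def)+
    then have "?B (?join (return_pmf 0) (\<lambda>_. return_pmf x)) = 0"
      by (subst symmetric_rate_bound_eq_rate_value) (auto simp: rate_value_def)
    with le[of "return_pmf 0" "\<lambda>_. return_pmf x"] show ?thesis by simp
  qed
  \<comment> \<open>Each choice contributes the interval from 0 to its bound, so the supremum is the
    largest bound.\<close>
  have S_eq: "?S = {R. \<exists>(q :: nat pmf) L. finite (set_pmf q) \<and> 0 \<le> R \<and> R \<le> ?B (?join q L)}"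
    by (simp add: finite_alphabets_superposition_iff shayevitz_wigger_superposition_iff[OF assms] cong: conj_cong)
  have "Sup ?S = ?B (?join pU0 K)"
    unfolding S_eq
  proof (rule cSup_eq_maximum)
    show "?B (?join pU0 K) \<in> {R. \<exists>(q :: nat pmf) L. finite (set_pmf q) \<and> 0 \<le> R \<and> R \<le> ?B (?join q L)}"
      using finU nonneg by (intro CollectI exI[of _ pU0] exI[of _ K]) simp
    show "R \<le> ?B (?join pU0 K)"
      if R: "R \<in> {R. \<exists>(q :: nat pmf) L. finite (set_pmf q) \<and> 0 \<le> R \<and> R \<le> ?B (?join q L)}" for R
    proof -
      obtain q :: "nat pmf" and L where "finite (set_pmf q)" "R \<le> ?B (?join q L)"
        using R by blast
      then show ?thesis using le[of q L] by linarith
    qed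
  qed
  then have R: "R_sym_sp pS W y1 y2 = ?B (?join pU0 K)"
    unfolding R_sym_sp_def .
  moreover have "finite (set_pmf (?join pU0 K))"
    using finU by simp
  \<comment> \<open>An arbitrary joint law is split into the marginal of U0 and the conditional pmfs
    of X, to which \<open>le\<close> applies.\<close>
  moreover have "?B pUX \<le> R_sym_sp pS W y1 y2" if "finite (set_pmf pUX)" for pUX
    using le[of "map_pmf fst pUX" "\<lambda>u. map_pmf snd (cond_pmf pUX {\<omega>. fst \<omega> = u})"] that
    unfolding R pmf_disintegration by simp
  ultimately show ?thesis by blast
qed

end
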